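(* Let $-\infty<a<b<+\infty$ and let $N\ge 3$ be an integer. Assume that the probability measure $\mu$ admits a density $f$ with respect to the Lebesgue measure which is positive and $\log$-concave on $(a,b)$ and vanishes outside $(a,b)$. Then the map $T:\overline{\mathcal{S}}^{a,b}_N\to\overline{\mathcal{S}}^{a,b}_N$ admits a unique fixed point $x^\star$ in $\overline{\mathcal{S}}^{a,b}_N$, and $x^\star\in\mathcal{S}^{a,b}_N$. Moreover, $\{a,x^\star_2,\ldots,x^\star_{N-1},b\}$ is the unique quadratic ($L^2$-) optimal dual quantization grid of $\mu$ at level $N$, and there exists $\rho\in[0,1)$ such that for every $x^{[0]}\in\overline{\mathcal{S}}^{a,b}_N$ the sequence defined by $x^{[\ell+1]}=T(x^{[\ell]})$, $\ell\ge 0$, satisfies, for every $\ell\in\mathbb{N}$, $$|x^{[\ell]}-x^\star|_{\ell^\infty}\le |x^{[0]}-x^\star|_{\ell^\infty}\,\rho^{\lfloor \ell/\widetilde N\rfloor},\qquad \widetilde N=\Big\lceil\frac N2\Big\rceil-1,$$ and, if $f$ is strictly $\log$-concave on $(a,b)$, $$|x^{[\ell]}-x^\star|_{\ell^\infty}\le |x^{[0]}-x^\star|_{\ell^\infty}\,\rho^{\ell}.$$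
   Context: $\mathcal{S}^{a,b}_N=\{(x_2,\ldots,x_{N-1})\in(a,b)^{N-2}: x_2<\cdots<x_{N-1}\}$ with closure $\overline{\mathcal{S}}^{a,b}_N=\{(x_2,\ldots,x_{N-1})\in[a,b]^{N-2}: x_2\le\cdots\le x_{N-1}\}$; always $x_1=a$ and $x_N=b$. $|\cdot|_{\ell^\infty}$ is the max norm on $\mathbb{R}^{N-2}$. $F(x)=\mu((-\infty,x])$ is the cumulative distribution function of $\mu$; it is an increasing homeomorphism from $[a,b]$ to $[0,1]$ with inverse $F^{-1}$. The map $T(x)=(T_2(x),\ldots,T_{N-1}(x))$ is defined for $x\in\overline{\mathcal{S}}^{a,b}_N$ and $i=2,\ldots,N-1$ by $$T_i(x)=F^{-1}\Big(\frac{1}{x_{i+1}-x_{i-1}}\int_{x_{i-1}}^{x_{i+1}}F(\xi)\,d\xi\Big)\ \text{ if } x_{i-1}<x_{i+1},\qquad T_i(x)=x_i\ \text{ if } x_{i-1}=x_i=x_{i+1}.$$ It is continuous and maps $\overline{\mathcal{S}}^{a,b}_N$ into itself. A dual quantization grid for $\mu$ at level $N$ is a finite set $\Gamma=\{x_1<\cdots<x_M\}\subset\mathbb{R}$, $M\le N$, with $x_1\le a$ and $x_M\ge b$. It is quadratic optimal at level $N$ if, among all such grids, it minimizes $$\sum_{i=1}^{M-1}\int_{[x_i,x_{i+1})}\Big((\xi-x_i)^2\frac{x_{i+1}-\xi}{x_{i+1}-x_i}+(x_{i+1}-\xi)^2\frac{\xi-x_i}{x_{i+1}-x_i}\Big)\mu(d\xi).$$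 *)

theory Defs
  imports "HOL-Probability.Probability"
begin

definition log_concave_on :: "real set \<Rightarrow> (real \<Rightarrow> real) \<Rightarrow> bool" where
  "log_concave_on S f \<longleftrightarrow> (\<forall>x\<in>S. 0 < f x) \<and> concave_on S (\<lambda>x. ln (f x))"

definition strictly_concave_on :: "real set \<Rightarrow> (real \<Rightarrow> real) \<Rightarrow> bool" where
  "strictly_concave_on S g \<longleftrightarrow> convex S \<and>
     (\<forall>x\<in>S. \<forall>y\<in>S. \<forall>u>0. \<forall>v>0. x \<noteq> y \<longrightarrow> u + v = 1 \<longrightarrow>
        u * g x + v * g y < g (u * x + v * y))"

definition strictly_log_concave_on :: "real set \<Rightarrow> (real \<Rightarrow> real) \<Rightarrow> bool" where
  "strictly_log_concave_on S f \<longleftrightarrow>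
     (\<forall>x\<in>S. 0 < f x) \<and> strictly_concave_on S (\<lambda>x. ln (f x))"

text \<open>
  A vector $(x_2,\ldots,x_{N-1})$ is a function on \<^typ>\<open>nat\<close> that is extensional outside
  \<open>{2..N-1}\<close>, so that equality of functions is equality of vectors.
\<close>

definition ordered_simplex :: "real \<Rightarrow> real \<Rightarrow> nat \<Rightarrow> (nat \<Rightarrow> real) set" where
  "ordered_simplex a b N = {x \<in> {2..N-1} \<rightarrow>\<^sub>E {a<..<b}. strict_mono_on {2..N-1} x}"

definition closed_ordered_simplex :: "real \<Rightarrow> real \<Rightarrow> nat \<Rightarrow> (nat \<Rightarrow> real) set" where
  "closed_ordered_simplex a b N = {x \<in> {2..N-1} \<rightarrow>\<^sub>E {a..b}. mono_on {2..N-1} x}"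

definition max_norm :: "nat \<Rightarrow> (nat \<Rightarrow> real) \<Rightarrow> real" where
  "max_norm N x = Max ((\<lambda>i. \<bar>x i\<bar>) ` {2..N-1})"

text \<open>The convention $x_1 = a$ and $x_N = b$.\<close>

definition with_endpoints :: "real \<Rightarrow> real \<Rightarrow> nat \<Rightarrow> (nat \<Rightarrow> real) \<Rightarrow> nat \<Rightarrow> real" where
  "with_endpoints a b N x = x(1 := a, N := b)"

text \<open>
  On the closed simplex, the negation of $x_{i-1} < x_{i+1}$ is $x_{i-1} = x_i = x_{i+1}$.
\<close>

definition grid_map :: "real measure \<Rightarrow> real \<Rightarrow> real \<Rightarrow> nat \<Rightarrow> (nat \<Rightarrow> real) \<Rightarrow> nat \<Rightarrow> real" where
  "grid_map \<mu> a b N x = (\<lambda>i\<in>{2..N-1}.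
     let l = with_endpoints a b N x (i - 1); r = with_endpoints a b N x (i + 1) in
     if l < r
     then the_inv_into {a..b} (cdf \<mu>) (1 / (r - l) * (LINT \<xi>:{l..r}|lborel. cdf \<mu> \<xi>))
     else x i)"

definition dual_quantization_grid :: "real \<Rightarrow> real \<Rightarrow> nat \<Rightarrow> real set \<Rightarrow> bool" where
  "dual_quantization_grid a b N \<Gamma> \<longleftrightarrow>
     finite \<Gamma> \<and> \<Gamma> \<noteq> {} \<and> card \<Gamma> \<le> N \<and> Min \<Gamma> \<le> a \<and> b \<le> Max \<Gamma>"

text \<open>
  The enumeration \<open>xs\<close> of the grid is indexed from 0, hence \<open>xs ! i\<close> is $x_{i+1}$.
\<close>

definition dual_distortion :: "real measure \<Rightarrow> real set \<Rightarrow> real" where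
  "dual_distortion \<mu> \<Gamma> = (let xs = sorted_list_of_set \<Gamma> in
     \<Sum>i<card \<Gamma> - 1. LINT \<xi>:{xs ! i..<xs ! (i + 1)}|\<mu>.
       (\<xi> - xs ! i)\<^sup>2 * ((xs ! (i + 1) - \<xi>) / (xs ! (i + 1) - xs ! i))
       + (xs ! (i + 1) - \<xi>)\<^sup>2 * ((\<xi> - xs ! i) / (xs ! (i + 1) - xs ! i)))"

definition quadratic_optimal_grid :: "real measure \<Rightarrow> real \<Rightarrow> real \<Rightarrow> nat \<Rightarrow> real set \<Rightarrow> bool" where
  "quadratic_optimal_grid \<mu> a b N = is_arg_min (dual_distortion \<mu>) (dual_quantization_grid a b N)"

end

theory Submission
  imports Defs
begin

text \<open>
  Let \<open>\<Phi>\<close> be an antiderivative of \<open>F\<close>, and let \<open>G(l, r) = F\<^sup>-\<^sup>1 ((\<Phi> r - \<Phi> l) / (r - l))\<close>, so that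
  \<open>T\<^sub>i(x) = G(x\<^sub>i\<^sub>-\<^sub>1, x\<^sub>i\<^sub>+\<^sub>1)\<close>. Both partial derivatives of \<open>G\<close> are positive, and their sum is the mean of
  \<open>f\<close> over \<open>[l, r]\<close> divided by \<open>f (G(l, r))\<close>. Log-concavity of \<open>f\<close> means that \<open>f \<circ> F\<^sup>-\<^sup>1\<close> is concave, so
  this sum is at most 1 by Jensen's inequality, and less than 1 in the strict case. Integrating along
  the segment from a fixed point, each step of \<open>T\<close> replaces the displacement of \<open>x\<^sub>i\<close> by at most a weighted
  mean of the displacements of its neighbours. As the end points do not move, the decay reaches the middle
  of the grid after \<open>\<lceil>N / 2\<rceil> - 1\<close> steps, which gives the rate and the uniqueness of the fixed point.

  Integration by parts turns the distortion of a grid into twice the error of the trapezoidal rule for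
  the convex function \<open>\<Phi>\<close>. It attains its minimum on the compact simplex, and \<open>T\<^sub>i\<close> minimizes it strictly
  in the \<open>i\<close>-th coordinate, so every minimizer is a fixed point of \<open>T\<close>. An arbitrary grid is compared
  with the one obtained by moving its points into \<open>[a, b]\<close>.
\<close>

section \<open>Tools from one-variable real analysis\<close>

lemma mvt_unordered:
  fixes h h' :: "real \<Rightarrow> real"
  assumes "x \<noteq> y"
    and "\<And>z. min x y \<le> z \<Longrightarrow> z \<le> max x y \<Longrightarrow> (h has_real_derivative h' z) (at z)"
  obtains z where "min x y < z" "z < max x y" "h y - h x = (y - x) * h' z"
proof (cases "x < y")
  case True
  then show ?thesis
    using MVT2[of x y h h'] assms(2) that by (auto simp: min_def max_def)
next
  case False
  then have "y < x" using assms(1) by simp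
  then obtain z where z: "z > y" "z < x" "h x - h y = (x - y) * h' z"
    using MVT2[of y x h h'] assms(2) by (auto simp: min_def max_def)
  then show ?thesis using that[of z] \<open>y < x\<close> by (auto simp: algebra_simps min_def max_def)
qed

lemma concave_on_supergradient:
  fixes g :: "real \<Rightarrow> real"
  assumes "open S" "concave_on S g" "c \<in> S"
  obtains s where "\<And>x. x \<in> S \<Longrightarrow> g x \<le> g c + s * (x - c)"
proof -
  have c: "convex_on S (\<lambda>x. - g x)" using assms(2) by (simp add: concave_on_def)
  have ci: "c \<in> interior S" using assms(1,3) by (simp add: interior_open)
  \<comment> \<open>This is the right derivative of \<open>g\<close> at \<open>c\<close>, written as
    minus the infimum of the right difference quotients of the convex function
    \<open>-g\<close>.\<close>
  define s where "s = - Inf ((\<lambda>t. (- g c - - g t) / (c - t)) ` ({c<..} \<inter> S))"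
  have "g x \<le> g c + s * (x - c)" if "x \<in> S" for x
    using convex_le_Inf_differential[OF c ci that] unfolding s_def by (simp add: algebra_simps)
  then show thesis by (rule that)
qed

text \<open>A concave function on an open set is continuous; this applies to \<open>ln f\<close>,
  and \<open>f\<close> is its exponential.\<close>

lemma log_concave_on_isCont:
  assumes "open S" "log_concave_on S f" "x \<in> S"
  shows "isCont f x"
proof -
  have pos: "0 < f x" if "x \<in> S" for x
    using assms(2) that by (simp add: log_concave_on_def)
  have "convex_on S (\<lambda>x. - ln (f x))"
    using assms(2) by (simp add: log_concave_on_def concave_on_def)
  then have "continuous_on S (\<lambda>x. - ln (f x))"
    by (intro convex_on_continuous assms(1))
  then have "continuous_on S (\<lambda>x. exp (- (- ln (f x))))"
    by (intro continuous_on_exp continuous_on_minus[of _ "\<lambda>x. - ln (f x)"])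
  also have "?this \<longleftrightarrow> continuous_on S f"
    by (rule continuous_on_cong) (auto simp: pos)
  finally show ?thesis using assms(1,3) by (simp add: continuous_on_eq_continuous_at)
qed

text \<open>Supplies \<Phi> and then \<Psi>. Fixing the constant so that both vanish to the left of
  \<open>a\<close> makes cells that reach below \<open>a\<close> explicitly computable.\<close>

lemma continuous_antiderivative_exists:
  fixes g :: "real \<Rightarrow> real"
  assumes "\<And>x. isCont g x" "\<And>x. x \<le> a \<Longrightarrow> g x = 0"
  obtains G where "\<And>x. (G has_real_derivative g x) (at x)" "\<And>x. x \<le> a \<Longrightarrow> G x = 0"
proof -
  obtain H where H: "\<And>x. (H has_vector_derivative g x) (at x)"
    using einterval_antiderivative[of "-\<infinity>" "\<infinity>" g] assms(1) by auto
  define G where "G x = H x - H a" for x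
  have d: "(G has_real_derivative g x) (at x)" for x
    using H[of x] unfolding G_def
    by (auto intro!: derivative_eq_intros simp: has_real_derivative_iff_has_vector_derivative)
  have "G x = 0" if "x \<le> a" for x
  proof (cases "x = a")
    case False
    then have "x < a" using that by simp
    then obtain z where "x < z" "z < a" "G a - G x = (a - x) * g z"
      using MVT2[of x a G g] d by blast
    then show ?thesis using assms(2)[of z] by (simp add: G_def)
  qed (simp add: G_def)
  with d show thesis by (rule that)
qed

section \<open>The distribution function of a log-concave density\<close>

text \<open>The contraction estimates and the comparison of grids are carried out from these
  analytic facts, without the measure. All functions live on the whole line because grid points may
  lie outside \<open>[a, b]\<close>.\<close>

locale log_concave_cdf =
  fixes a b :: real and f F \<Phi> \<Psi> :: "real \<Rightarrow> real"
  assumes a_less_b: "a < b"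
    and log_concave: "log_concave_on {a<..<b} f"
    and cdf_left: "\<And>x. x \<le> a \<Longrightarrow> F x = 0"
    and cdf_right: "\<And>x. b \<le> x \<Longrightarrow> F x = 1"
    and cdf_cont: "\<And>x. isCont F x"
    and cdf_deriv: "\<And>x. x \<in> {a<..<b} \<Longrightarrow> (F has_real_derivative f x) (at x)"
    and Phi_deriv: "\<And>x. (\<Phi> has_real_derivative F x) (at x)"
    and Phi_left: "\<And>x. x \<le> a \<Longrightarrow> \<Phi> x = 0"
    and Psi_deriv: "\<And>x. (\<Psi> has_real_derivative \<Phi> x) (at x)"
    and Psi_left: "\<And>x. x \<le> a \<Longrightarrow> \<Psi> x = 0"
begin

lemma density_pos: "x \<in> {a<..<b} \<Longrightarrow> 0 < f x"
  using log_concave by (simp add: log_concave_on_def)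

lemma density_cont: "x \<in> {a<..<b} \<Longrightarrow> isCont f x"
  by (rule log_concave_on_isCont[OF _ log_concave]) auto

lemma cdf_strict_mono: "a \<le> x \<Longrightarrow> x < y \<Longrightarrow> y \<le> b \<Longrightarrow> F x < F y"
  by (rule DERIV_pos_imp_increasing_open)
    (use cdf_deriv density_pos cdf_cont in \<open>auto intro!: continuous_at_imp_continuous_on\<close>, force)

lemma cdf_mono: "x \<le> y \<Longrightarrow> F x \<le> F y"
proof -
  have *: "F x \<le> F y" if "a \<le> x" "x \<le> y" "y \<le> b" for x y
    using cdf_strict_mono[of x y] that by (cases "x = y") auto
  assume "x \<le> y"
  \<comment> \<open>\<open>F\<close> is constant on each side of \<open>[a, b]\<close>, so
    projecting both arguments onto the interval leaves its values unchanged.\<close>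
  then have "F (max a (min b x)) \<le> F (max a (min b y))"
    using a_less_b by (intro *) (auto simp: min_def max_def)
  moreover have "F (max a (min b z)) = F z" for z
    using a_less_b cdf_left[of z] cdf_left[of a] cdf_right[of z] cdf_right[of b]
    by (cases "z \<le> a"; cases "b \<le> z") (auto simp: min_def max_def)
  ultimately show ?thesis by simp
qed

lemma cdf_less_iff: "x \<in> {a..b} \<Longrightarrow> y \<in> {a..b} \<Longrightarrow> F x < F y \<longleftrightarrow> x < y"
  using cdf_strict_mono[of x y] cdf_mono[of y x] by (auto simp: not_le[symmetric])

lemma cdf_inj: "inj_on F {a..b}"
  by (rule inj_onI) (metis cdf_less_iff linorder_neq_iff)

text \<open>The tangent-line inequality says that \<open>f \<circ> F\<^sup>-\<^sup>1\<close> is concave.\<close>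

lemma density_le_tangent:
  assumes "c \<in> {a<..<b}"
  obtains s where "\<And>x. x \<in> {a<..<b} \<Longrightarrow> f x \<le> f c + s * (F x - F c)"
    and "\<And>x. strictly_log_concave_on {a<..<b} f \<Longrightarrow> x \<in> {a<..<b} \<Longrightarrow> x \<noteq> c \<Longrightarrow>
      f x < f c + s * (F x - F c)"
proof -
  define g where "g x = ln (f x)" for x
  have conc: "concave_on {a<..<b} g"
    using log_concave by (simp add: log_concave_on_def g_def[abs_def])
  obtain s where s: "\<And>x. x \<in> {a<..<b} \<Longrightarrow> g x \<le> g c + s * (x - c)"
    using concave_on_supergradient[OF _ conc assms] by auto
  have f_g: "f x = exp (g x)" if "x \<in> {a<..<b}" for x
    using density_pos[OF that] by (simp add: g_def)
  \<comment> \<open>Between \<open>c\<close> and \<open>x\<close> the concave \<open>g\<close> lies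
    above its chord, so the supergradient bound on the increment from \<open>c\<close> to
    \<open>x\<close> passes to the increment from \<open>t\<close> to \<open>x\<close>.\<close>
  have chord: "g x - g t \<le> s * (x - t)"
    if x: "x \<in> {a<..<b}" "x \<noteq> c" and t: "min c x \<le> t" "t \<le> max c x" for x t
  proof -
    define u where "u = (t - c) / (x - c)"
    have u: "0 \<le> u" "u \<le> 1"
      using x(2) t by (auto simp: u_def divide_simps min_def max_def split: if_splits)
    have "u * (x - c) = t - c" using x(2) by (simp add: u_def)
    then have tu: "t = (1 - u) * c + u * x" by (simp add: algebra_simps)
    have "g t \<ge> (1 - u) * g c + u * g x"
      using concave_onD[OF conc u assms x(1)] by (simp add: tu)
    then have "g x - g t \<le> (1 - u) * (g x - g c)" by (simp add: algebra_simps)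
    also have "\<dots> \<le> (1 - u) * (s * (x - c))"
      using s[OF x(1)] u by (intro mult_left_mono) auto
    also have "\<dots> = s * (x - t)" by (simp add: tu algebra_simps)
    finally show ?thesis .
  qed
  \<comment> \<open>An exponential with rate \<open>s\<close> has an increment equal to
    \<open>s\<close> times its integral, so \<open>f\<close> is compared with such an exponential.
    If \<open>s * (x - c)\<close> is nonnegative, it is anchored at \<open>x\<close> and lies below
    \<open>f\<close> by \<open>chord\<close>; otherwise it is anchored at \<open>c\<close> and lies
    above \<open>f\<close> by the supergradient bound. In both cases multiplying by
    \<open>s * (x - c)\<close> turns the comparison the right way.\<close>
  have key: "f x - f c \<le> s * (F x - F c) \<and> (g x < g c + s * (x - c) \<longrightarrow> f x - f c < s * (F x - F c))"
    if x: "x \<in> {a<..<b}" "x \<noteq> c" for x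
  proof -
    have seg: "z \<in> {a<..<b}" if "min c x \<le> z" "z \<le> max c x" for z
      using that assms x by (auto simp: min_def max_def split: if_splits)
    show ?thesis
    proof (cases "0 \<le> s * (x - c)")
      case True
      obtain z where z: "min c x < z" "z < max c x"
        and eq: "(s * F x - f x * exp (s * (x - x))) - (s * F c - f x * exp (s * (c - x)))
          = (x - c) * (s * f z - f x * (exp (s * (z - x)) * s))"
        by (rule mvt_unordered[of c x "\<lambda>t. s * F t - f x * exp (s * (t - x))"
              "\<lambda>t. s * f t - f x * (exp (s * (t - x)) * s)"])
          (use x seg in \<open>auto intro!: derivative_eq_intros cdf_deriv\<close>)
      have "f x * exp (s * (z - x)) = exp (g x - s * (x - z))"
        by (simp add: f_g[OF x(1)] exp_add[symmetric] algebra_simps)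
      also have "\<dots> \<le> f z"
        using chord[OF x, of z] z seg[of z] by (simp add: f_g)
      finally have "0 \<le> (s * (x - c)) * (f z - f x * exp (s * (z - x)))"
        using True by simp
      then have 1: "f x - f x * exp (s * (c - x)) \<le> s * (F x - F c)"
        using eq by (simp add: algebra_simps)
      have 2: "f x * exp (s * (c - x)) = exp (g x - s * (x - c))"
        by (simp add: f_g[OF x(1)] exp_add[symmetric] algebra_simps)
      have "exp (g x - s * (x - c)) \<le> f c"
        using s[OF x(1)] by (simp add: f_g[OF assms])
      moreover have "g x < g c + s * (x - c) \<longrightarrow> exp (g x - s * (x - c)) < f c"
        by (simp add: f_g[OF assms])
      ultimately show ?thesis using 1 2 by auto
    next
      case False
      obtain z where z: "min c x < z" "z < max c x"
        and eq: "(s * F x - f c * exp (s * (x - c))) - (s * F c - f c * exp (s * (c - c)))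
          = (x - c) * (s * f z - f c * (exp (s * (z - c)) * s))"
        by (rule mvt_unordered[of c x "\<lambda>t. s * F t - f c * exp (s * (t - c))"
              "\<lambda>t. s * f t - f c * (exp (s * (t - c)) * s)"])
          (use x seg in \<open>auto intro!: derivative_eq_intros cdf_deriv\<close>)
      have e: "f c * exp (s * (y - c)) = exp (g c + s * (y - c))" for y
        by (simp add: f_g[OF assms] exp_add)
      have "f z \<le> f c * exp (s * (z - c))"
        unfolding e using s[of z] z seg[of z] by (simp add: f_g)
      then have "0 \<le> (s * (x - c)) * (f z - f c * exp (s * (z - c)))"
        using False by (intro mult_nonpos_nonpos) auto
      then have 1: "f c * exp (s * (x - c)) - f c \<le> s * (F x - F c)"
        using eq by (simp add: algebra_simps)
      have "f x \<le> f c * exp (s * (x - c))"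
        unfolding e using s[OF x(1)] by (simp add: f_g[OF x(1)])
      moreover have "g x < g c + s * (x - c) \<longrightarrow> f x < f c * exp (s * (x - c))"
        unfolding e by (simp add: f_g[OF x(1)])
      ultimately show ?thesis using 1 by auto
    qed
  qed
  show thesis
  proof (rule that[of s])
    fix x assume x: "x \<in> {a<..<b}"
    show "f x \<le> f c + s * (F x - F c)"
      using key[OF x] by (cases "x = c") auto
  next
    fix x assume sl: "strictly_log_concave_on {a<..<b} f" and x: "x \<in> {a<..<b}" "x \<noteq> c"
    \<comment> \<open>Strict concavity at the midpoint, combined with the supergradient bound there,
      makes the bound at \<open>x\<close> strict.\<close>
    define m where "m = 1/2 * x + 1/2 * c"
    have m: "m \<in> {a<..<b}" using x assms by (auto simp: m_def)
    have "\<And>u v. 0 < u \<Longrightarrow> 0 < v \<Longrightarrow> u + v = 1 \<Longrightarrow> u * g x + v * g c < g (u * x + v * c)"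
      using sl x assms unfolding strictly_log_concave_on_def strictly_concave_on_def g_def by blast
    from this[of "1/2" "1/2"] have "1/2 * g x + 1/2 * g c < g m"
      by (simp add: m_def)
    also have "\<dots> \<le> g c + s * (m - c)" using s[OF m] .
    also have "m - c = 1/2 * (x - c)" by (simp add: m_def algebra_simps)
    finally have "g x < g c + s * (x - c)" by (simp add: field_simps)
    then show "f x < f c + s * (F x - F c)"
      using key[OF x] by auto
  qed
qed

section \<open>Contraction properties of a single node\<close>

abbreviation quantile :: "real \<Rightarrow> real" where
  "quantile \<equiv> the_inv_into {a..b} F"

text \<open>The map \<open>G\<close> of the outline. Since the node lies between its arguments, the
  value chosen on the diagonal is the limit reached when \<open>l\<close> and \<open>r\<close>
  merge.\<close>

definition node :: "real \<Rightarrow> real \<Rightarrow> real" where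
  "node l r = (if l < r then quantile ((\<Phi> r - \<Phi> l) / (r - l)) else l)"

text \<open>The partial derivative of \<open>node\<close> in its first argument;
  \<open>rweight\<close> is the one in the second. See \<open>node_deriv\<close>.\<close>

definition lweight :: "real \<Rightarrow> real \<Rightarrow> real" where
  "lweight l r = (F (node l r) - F l) / ((r - l) * f (node l r))"

definition rweight :: "real \<Rightarrow> real \<Rightarrow> real" where
  "rweight l r = (F r - F (node l r)) / ((r - l) * f (node l r))"

lemma quantile_cdf: "x \<in> {a..b} \<Longrightarrow> quantile (F x) = x"
  by (rule the_inv_into_f_f[OF cdf_inj])

lemma cdf_image: "F ` {a..b} = {0..1}"
proof
  show "F ` {a..b} \<subseteq> {0..1}"
    using cdf_mono[of a] cdf_mono[of _ b] cdf_left[of a] cdf_right[of b] by fastforce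
  show "{0..1} \<subseteq> F ` {a..b}"
    using IVT'[of F a _ b] a_less_b cdf_left[of a] cdf_right[of b] cdf_cont
    by (fastforce intro: continuous_at_imp_continuous_on)
qed

lemma quantile_deriv:
  assumes "c \<in> {a<..<b}"
  shows "(quantile has_real_derivative inverse (f c)) (at (F c))"
proof (rule DERIV_inverse_function)
  have Fc: "0 < F c" "F c < 1"
    using cdf_strict_mono[of a c] cdf_strict_mono[of c b] assms a_less_b
      cdf_left[of a] cdf_right[of b] by auto
  show "0 < F c" "F c < 1" by fact+
  show "(F has_real_derivative f c) (at (quantile (F c)))"
    using cdf_deriv assms by (simp add: quantile_cdf)
  show "f c \<noteq> 0" using density_pos[OF assms] by simp
  show "F (quantile y) = y" if "0 < y" "y < 1" for y
    using that by (intro f_the_inv_into_f[OF cdf_inj]) (simp add: cdf_image)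
  have "continuous_on (F ` {a..b}) quantile"
    by (rule continuous_on_inv)
      (auto intro!: continuous_at_imp_continuous_on cdf_cont quantile_cdf)
  then show "isCont quantile (F c)"
    unfolding cdf_image using Fc by (intro continuous_on_interior[of "{0..1}"]) auto
qed

text \<open>The mean value theorem for \<Phi> yields an interior point at which \<open>F\<close>
  takes its mean over \<open>[l, r]\<close>; as \<open>F\<close> is injective on
  \<open>[a, b]\<close>, that point is the node.\<close>

lemma node_between:
  assumes "a \<le> l" "l < r" "r \<le> b"
  shows "l < node l r" and "node l r < r"
    and Phi_diff: "\<Phi> r - \<Phi> l = (r - l) * F (node l r)"
proof -
  obtain z where z: "l < z" "z < r" "\<Phi> r - \<Phi> l = (r - l) * F z"
    using MVT2[OF assms(2), of \<Phi> F] Phi_deriv by blast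
  then have "node l r = z"
    using assms quantile_cdf[of z] by (simp add: node_def)
  with z show "l < node l r" "node l r < r" "\<Phi> r - \<Phi> l = (r - l) * F (node l r)" by auto
qed

lemma node_inside: "a \<le> l \<Longrightarrow> l < r \<Longrightarrow> r \<le> b \<Longrightarrow> node l r \<in> {a<..<b}"
  using node_between[of l r] by auto

lemma node_refl [simp]: "node l l = l"
  by (simp add: node_def)

lemma node_mem: "l \<le> r \<Longrightarrow> a \<le> l \<Longrightarrow> r \<le> b \<Longrightarrow> l \<le> node l r \<and> node l r \<le> r"
  using node_between[of l r] by (cases "l = r") auto

lemma node_deriv:
  assumes u: "(u has_real_derivative u') (at t)" and v: "(v has_real_derivative v') (at t)"
    and ord: "a \<le> u t" "u t < v t" "v t \<le> b"
  shows "((\<lambda>s. node (u s) (v s)) has_real_derivative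
      lweight (u t) (v t) * u' + rweight (u t) (v t) * v') (at t)"
proof -
  let ?c = "node (u t) (v t)"
  let ?A = "\<lambda>s. (\<Phi> (v s) - \<Phi> (u s)) / (v s - u s)"
  have c: "?c \<in> {a<..<b}" using node_inside[OF ord] .
  have Phi: "\<Phi> (v t) - \<Phi> (u t) = (v t - u t) * F ?c" using Phi_diff[OF ord] .
  then have At: "?A t = F ?c" using ord by simp
  have d\<Phi>: "((\<lambda>s. \<Phi> (v s) - \<Phi> (u s)) has_real_derivative F (v t) * v' - F (u t) * u') (at t)"
    by (intro derivative_intros DERIV_chain2[of \<Phi>] Phi_deriv u v)
  have dA: "(?A has_real_derivative
      ((F ?c - F (u t)) * u' + (F (v t) - F ?c) * v') / (v t - u t)) (at t)"
  proof -
    have "(?A has_real_derivative ((F (v t) * v' - F (u t) * u') * (v t - u t)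
        - (\<Phi> (v t) - \<Phi> (u t)) * (v' - u')) / ((v t - u t) * (v t - u t))) (at t)"
      using ord by (intro DERIV_divide d\<Phi> DERIV_diff v u) auto
    also have "((F (v t) * v' - F (u t) * u') * (v t - u t)
        - (\<Phi> (v t) - \<Phi> (u t)) * (v' - u')) / ((v t - u t) * (v t - u t))
      = ((F ?c - F (u t)) * u' + (F (v t) - F ?c) * v') / (v t - u t)"
      unfolding Phi using ord by (simp add: divide_simps) algebra
    finally show ?thesis .
  qed
  have "((\<lambda>s. quantile (?A s)) has_real_derivative
      inverse (f ?c) * (((F ?c - F (u t)) * u' + (F (v t) - F ?c) * v') / (v t - u t))) (at t)"
    by (rule DERIV_chain2[OF _ dA]) (unfold At, rule quantile_deriv[OF c])
  also have "inverse (f ?c) * (((F ?c - F (u t)) * u' + (F (v t) - F ?c) * v') / (v t - u t))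
      = lweight (u t) (v t) * u' + rweight (u t) (v t) * v'"
    by (simp add: lweight_def rweight_def divide_simps)
  finally have *: "((\<lambda>s. quantile (?A s)) has_real_derivative
      lweight (u t) (v t) * u' + rweight (u t) (v t) * v') (at t)" .
  \<comment> \<open>The quantile formula for \<open>node\<close> requires strictly ordered
    arguments; by continuity they stay so near \<open>t\<close>.\<close>
  have "((\<lambda>s. v s - u s) \<longlongrightarrow> v t - u t) (nhds t)"
    using DERIV_isCont[OF DERIV_diff[OF v u]]
      tendsto_at_iff_tendsto_nhds[of "\<lambda>s. v s - u s" t] by (simp add: isCont_def)
  then have "\<forall>\<^sub>F s in nhds t. 0 < v s - u s"
    by (rule order_tendstoD) (use ord in simp)
  then have "\<forall>\<^sub>F s in nhds t. node (u s) (v s) = quantile (?A s)"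
    by eventually_elim (simp add: node_def)
  from DERIV_cong_ev[OF refl this refl] * show ?thesis by simp
qed

lemma weight_pos:
  assumes "a \<le> l" "l < r" "r \<le> b"
  shows "0 < lweight l r" and "0 < rweight l r"
proof -
  note n = node_between[OF assms]
  have "0 < f (node l r)" using density_pos[OF node_inside[OF assms]] .
  moreover have "F l < F (node l r)" "F (node l r) < F r"
    using n assms by (auto intro!: cdf_strict_mono)
  ultimately show "0 < lweight l r" "0 < rweight l r"
    using assms by (auto simp: lweight_def rweight_def)
qed

text \<open>
  By Jensen's inequality for \<open>f \<circ> F\<^sup>-\<^sup>1\<close>, the mean of \<open>f\<close> over \<open>[l, r]\<close> is at most
  \<open>f (F\<^sup>-\<^sup>1 m)\<close>, where \<open>m\<close> is the mean of \<open>F\<close>.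
\<close>

lemma weight_sum:
  assumes "a \<le> l" "l < r" "r \<le> b"
  shows weight_sum_le: "lweight l r + rweight l r \<le> 1"
    and weight_sum_less: "strictly_log_concave_on {a<..<b} f \<Longrightarrow> lweight l r + rweight l r < 1"
proof -
  define c where "c = node l r"
  have c: "c \<in> {a<..<b}" "l < c" "c < r"
    using node_inside[OF assms] node_between[OF assms] by (auto simp: c_def)
  have fc: "0 < f c" using density_pos[OF c(1)] .
  obtain s where s: "\<And>x. x \<in> {a<..<b} \<Longrightarrow> f x \<le> f c + s * (F x - F c)"
    and s': "\<And>x. strictly_log_concave_on {a<..<b} f \<Longrightarrow> x \<in> {a<..<b} \<Longrightarrow> x \<noteq> c \<Longrightarrow>
      f x < f c + s * (F x - F c)"
    using density_le_tangent[OF c(1)] by blast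
  \<comment> \<open>The derivative of \<open>W\<close> is the gap in the tangent inequality. As
    \<open>F c\<close> is the mean of \<open>F\<close> over \<open>[l, r]\<close>, the term with
    \<open>s\<close> has the same value at \<open>l\<close> and \<open>r\<close>, so the slope drops
    out of \<open>W r - W l\<close>.\<close>
  define W where "W x = f c * x + s * (\<Phi> x - F c * x) - F x" for x
  have W_deriv: "(W has_real_derivative f c + s * (F x - F c) - f x) (at x)" if "x \<in> {a<..<b}" for x
    unfolding W_def by (auto intro!: derivative_eq_intros Phi_deriv cdf_deriv that)
  have "continuous_on UNIV \<Phi>"
    by (intro continuous_at_imp_continuous_on ballI DERIV_isCont[OF Phi_deriv])
  moreover have "continuous_on UNIV F"
    by (intro continuous_at_imp_continuous_on ballI cdf_cont)
  ultimately have W_cont: "continuous_on {x..y} W" for x y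
    unfolding W_def by (intro continuous_intros) (auto elim: continuous_on_subset)
  have le: "W x \<le> W y" if "l \<le> x" "x \<le> y" "y \<le> r" for x y
  proof (rule DERIV_nonneg_imp_increasing_open[OF that(2) _ W_cont])
    show "\<exists>y. (W has_real_derivative y) (at z) \<and> 0 \<le> y" if "x < z" "z < y" for z
    proof -
      have "z \<in> {a<..<b}" using that \<open>l \<le> x\<close> \<open>y \<le> r\<close> assms by simp
      then show ?thesis using W_deriv[of z] s[of z] by auto
    qed
  qed
  \<comment> \<open>The tangent inequality is strict away from \<open>c\<close>, so one of the two
    halves already yields a strict increase.\<close>
  have less: "W c < W r" if "strictly_log_concave_on {a<..<b} f"
  proof (rule DERIV_pos_imp_increasing_open[OF c(3) _ W_cont])
    show "\<exists>y. (W has_real_derivative y) (at z) \<and> 0 < y" if "c < z" "z < r" for z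
    proof -
      have "z \<in> {a<..<b}" "z \<noteq> c" using that c assms by simp_all
      then show ?thesis
        using W_deriv[of z] s'[OF \<open>strictly_log_concave_on {a<..<b} f\<close>, of z] by auto
    qed
  qed
  have W_diff: "W r - W l = (r - l) * f c - (F r - F l)"
    using Phi_diff[OF assms] unfolding W_def c_def[symmetric] by algebra
  have "lweight l r + rweight l r = (F r - F l) / ((r - l) * f c)"
    by (simp add: lweight_def rweight_def c_def add_divide_distrib[symmetric])
  also have "\<dots> = 1 - (W r - W l) / ((r - l) * f c)"
    unfolding W_diff using assms fc by (simp add: field_simps)
  finally have eq: "lweight l r + rweight l r = 1 - (W r - W l) / ((r - l) * f c)" .
  have pos: "0 < (r - l) * f c" using assms fc by simp
  show "lweight l r + rweight l r \<le> 1"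
    unfolding eq using le[of l r] assms pos by simp
  show "lweight l r + rweight l r < 1" if "strictly_log_concave_on {a<..<b} f"
    unfolding eq using le[of l c] less[OF that] c pos by simp
qed

text \<open>The mean value theorem for \<open>node\<close> along the segment from
  \<open>(p, q)\<close> to \<open>(l, r)\<close>. The target pair may be degenerate, since
  neighbouring points of an arbitrary starting vector may coincide; the segment is then strictly
  ordered up to time 1 only.\<close>

lemma node_path_mvt:
  assumes pq: "a \<le> p" "p < q" "q \<le> b" and lr: "a \<le> l" "l \<le> r" "r \<le> b"
    and st: "0 \<le> s" "s < t" "t \<le> 1"
  defines "u \<equiv> \<lambda>t. p + t * (l - p)" and "v \<equiv> \<lambda>t. q + t * (r - q)"
  obtains z where "s < z" "z < t" "a \<le> u z" "u z < v z" "v z \<le> b"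
    "node (u t) (v t) - node (u s) (v s)
      = (t - s) * (lweight (u z) (v z) * (l - p) + rweight (u z) (v z) * (r - q))"
proof -
  let ?w = "\<lambda>t. node (u t) (v t)"
  have uv: "a \<le> u z" "v z \<le> b" "u z \<le> v z" "z < 1 \<or> l < r \<Longrightarrow> u z < v z" if z: "0 \<le> z" "z \<le> 1" for z
  proof -
    have u: "u z = (1 - z) * p + z * l" and v: "v z = (1 - z) * q + z * r"
      by (simp_all add: u_def v_def algebra_simps)
    have "(1 - z) * a + z * a \<le> (1 - z) * p + z * l"
      using z pq lr by (intro add_mono mult_left_mono) auto
    then show "a \<le> u z" by (simp add: u algebra_simps)
    have "(1 - z) * q + z * r \<le> (1 - z) * b + z * b"
      using z pq lr by (intro add_mono mult_left_mono) auto
    then show "v z \<le> b" by (simp add: v algebra_simps)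
    show "u z \<le> v z"
      unfolding u v using z pq lr by (intro add_mono mult_left_mono) auto
    show "u z < v z" if "z < 1 \<or> l < r"
    proof (cases "z < 1")
      case True
      then show ?thesis
        unfolding u v using z pq lr by (intro add_less_le_mono mult_left_mono mult_strict_left_mono) auto
    next
      case False
      then have "z = 1" using z by simp
      then show ?thesis using that by (simp add: u_def v_def)
    qed
  qed
  have der: "(?w has_real_derivative
      lweight (u z) (v z) * (l - p) + rweight (u z) (v z) * (r - q)) (at z)"
    if "0 \<le> z" "z \<le> 1" "z < 1 \<or> l < r" for z
  proof (rule node_deriv)
    show "(u has_real_derivative l - p) (at z)" "(v has_real_derivative r - q) (at z)"
      unfolding u_def v_def by (auto intro!: derivative_eq_intros)
  qed (use uv that in auto)
  have "continuous_on {0..1} ?w"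
    unfolding continuous_on_def
  proof
    fix z :: real assume z: "z \<in> {0..1}"
    show "(?w \<longlongrightarrow> ?w z) (at z within {0..1})"
    proof (cases "z < 1 \<or> l < r")
      case True
      then show ?thesis
        using DERIV_isCont[OF der, of z] z by (auto simp: isCont_def intro: Lim_at_imp_Lim_at_within)
    next
      \<comment> \<open>At the degenerate end of the segment \<open>node\<close> need not be
        differentiable; it is continuous there because it is squeezed between its two merging
        arguments.\<close>
      case False
      then have z1: "z = 1" and "l = r" using z lr by auto
      have u1: "(u \<longlongrightarrow> l) (at 1 within {0..1})" and v1: "(v \<longlongrightarrow> l) (at 1 within {0..1})"
        unfolding u_def v_def using \<open>l = r\<close> by (auto intro!: tendsto_eq_intros)
      have mem: "u x \<le> ?w x \<and> ?w x \<le> v x" if "x \<in> {0..1}" for x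
        using node_mem[of "u x" "v x"] uv(1-3)[of x] that by auto
      have "?w z = l" using z1 \<open>l = r\<close> by (simp add: u_def v_def)
      moreover have "(?w \<longlongrightarrow> l) (at 1 within {0..1})"
      proof (rule tendsto_sandwich[OF _ _ u1 v1])
        show "\<forall>\<^sub>F x in at 1 within {0..1}. u x \<le> ?w x" "\<forall>\<^sub>F x in at 1 within {0..1}. ?w x \<le> v x"
          using mem by (auto simp: eventually_at_filter)
      qed
      ultimately show ?thesis using z1 by simp
    qed
  qed
  then have cont: "continuous_on {s..t} ?w" by (rule continuous_on_subset) (use st in auto)
  have "?w differentiable (at x)" if "s < x" "x < t" for x
    using der[of x] that st by (auto simp: real_differentiable_def)
  from MVT[OF st(2) cont this] obtain k z where z: "s < z" "z < t" "(?w has_real_derivative k) (at z)" "?w t - ?w s = (t - s) * k"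
    by blast
  have "k = lweight (u z) (v z) * (l - p) + rweight (u z) (v z) * (r - q)"
    using DERIV_unique[OF z(3) der] z st by auto
  with z uv[of z] st show thesis by (intro that[of z]) auto
qed

end

section \<open>Weighted sums and uniform neighbourhoods of segments\<close>

lemma abs_weighted_sum_le:
  fixes x y :: real
  assumes "0 \<le> \<alpha>" "0 \<le> \<beta>" "\<alpha> + \<beta> \<le> k"
  shows "\<bar>\<alpha> * x + \<beta> * y\<bar> \<le> k * max \<bar>x\<bar> \<bar>y\<bar>"
proof -
  have "\<bar>\<alpha> * x + \<beta> * y\<bar> \<le> \<alpha> * \<bar>x\<bar> + \<beta> * \<bar>y\<bar>"
    using abs_triangle_ineq[of "\<alpha> * x" "\<beta> * y"] assms by (simp add: abs_mult)
  also have "\<dots> \<le> \<alpha> * max \<bar>x\<bar> \<bar>y\<bar> + \<beta> * max \<bar>x\<bar> \<bar>y\<bar>"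
    using assms by (intro add_mono mult_left_mono) auto
  also have "\<dots> \<le> k * max \<bar>x\<bar> \<bar>y\<bar>"
    unfolding distrib_right[symmetric] using assms(3) by (intro mult_right_mono) auto
  finally show ?thesis .
qed

text \<open>Each weight is at least \<theta>, so whichever argument is smaller in absolute value
  receives at least \<theta>; what remains of the total weight is at most
  \<open>1 - \<theta>\<close>.\<close>

lemma abs_weighted_sum_le_max_min:
  fixes x y :: real
  assumes "0 \<le> \<theta>" "\<theta> \<le> \<alpha>" "\<theta> \<le> \<beta>" "\<alpha> + \<beta> \<le> 1"
  shows "\<bar>\<alpha> * x + \<beta> * y\<bar> \<le> (1 - \<theta>) * max \<bar>x\<bar> \<bar>y\<bar> + \<theta> * min \<bar>x\<bar> \<bar>y\<bar>"
proof -
  have *: "\<alpha> * x + \<beta> * y \<le> (1 - \<theta>) * y + \<theta> * x"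
    if "\<theta> \<le> \<alpha>" "\<alpha> + \<beta> \<le> 1" "0 \<le> x" "x \<le> y" for \<alpha> \<beta> x y :: real
  proof -
    have "\<beta> * y \<le> (1 - \<alpha>) * y" using that by (intro mult_right_mono) auto
    moreover have "\<theta> * (y - x) \<le> \<alpha> * (y - x)" using that by (intro mult_right_mono) auto
    ultimately show ?thesis by (simp add: algebra_simps)
  qed
  have "\<bar>\<alpha> * x + \<beta> * y\<bar> \<le> \<alpha> * \<bar>x\<bar> + \<beta> * \<bar>y\<bar>"
    using abs_triangle_ineq[of "\<alpha> * x" "\<beta> * y"] assms by (simp add: abs_mult)
  also have "\<dots> \<le> (1 - \<theta>) * max \<bar>x\<bar> \<bar>y\<bar> + \<theta> * min \<bar>x\<bar> \<bar>y\<bar>"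
    using *[of \<alpha> \<beta> "\<bar>x\<bar>" "\<bar>y\<bar>"] *[of \<beta> \<alpha> "\<bar>y\<bar>" "\<bar>x\<bar>"] assms
    by (cases "\<bar>x\<bar> \<le> \<bar>y\<bar>") (auto simp: max_def min_def)
  finally show ?thesis .
qed

lemma isCont_tendsto_nhds: "isCont h x \<Longrightarrow> (h \<longlongrightarrow> h x) (nhds x)"
  by (simp add: isCont_def tendsto_at_iff_tendsto_nhds)

text \<open>All targets lie in \<open>[a, b]\<close>, so the displacements are bounded and one
  \<tau> serves every segment starting at \<open>(p, q)\<close>.\<close>

lemma eventually_nhds_segment:
  fixes p q a b :: real
  assumes "eventually P (nhds (p, q))" "a < b" "p \<in> {a..b}" "q \<in> {a..b}"
  obtains \<tau> where "0 < \<tau>" "\<tau> \<le> 1"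
    "\<And>l r t. l \<in> {a..b} \<Longrightarrow> r \<in> {a..b} \<Longrightarrow> 0 \<le> t \<Longrightarrow> t \<le> \<tau> \<Longrightarrow>
      P (p + t * (l - p), q + t * (r - q))"
proof -
  obtain d where d: "0 < d" "\<And>z. dist z (p, q) < d \<Longrightarrow> P z"
    using assms(1) by (auto simp: eventually_nhds_metric)
  \<comment> \<open>The two displacements add up to at most \<open>2 * (b - a)\<close>, so this
    choice keeps the moving pair within \<open>d / 2\<close> of \<open>(p, q)\<close>.\<close>
  define \<tau> where "\<tau> = min 1 (d / (4 * (b - a)))"
  have \<tau>: "0 < \<tau>" "\<tau> \<le> 1" "\<tau> * (2 * (b - a)) < d"
  proof -
    have "\<tau> * (2 * (b - a)) \<le> d / (4 * (b - a)) * (2 * (b - a))"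
      using assms(2) by (intro mult_right_mono) (auto simp: \<tau>_def)
    also have "\<dots> < d" using assms(2) d(1) by (simp add: field_simps)
    finally show "\<tau> * (2 * (b - a)) < d" .
  qed (use assms(2) d(1) in \<open>auto simp: \<tau>_def\<close>)
  have "P (p + t * (l - p), q + t * (r - q))"
    if "l \<in> {a..b}" "r \<in> {a..b}" "0 \<le> t" "t \<le> \<tau>" for l r t
  proof (rule d(2))
    have "dist (p + t * (l - p), q + t * (r - q)) (p, q) \<le> \<bar>t * (l - p)\<bar> + \<bar>t * (r - q)\<bar>"
      by (simp add: dist_Pair_Pair dist_real_def sqrt_sum_squares_le_sum_abs)
    also have "\<dots> = t * (\<bar>l - p\<bar> + \<bar>r - q\<bar>)"
      using that(3) by (simp add: abs_mult distrib_left)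
    also have "\<dots> \<le> \<tau> * (2 * (b - a))"
      using that assms(3,4) \<tau>(1) by (intro mult_mono) auto
    also have "\<dots> < d" by fact
    finally show "dist (p + t * (l - p), q + t * (r - q)) (p, q) < d" .
  qed
  with \<tau>(1,2) show thesis by (rule that)
qed

section \<open>Estimates around a fixed pair of neighbours\<close>

context log_concave_cdf
begin

lemma node_isCont:
  assumes "a \<le> p" "p < q" "q \<le> b"
  shows "isCont (\<lambda>z. node (fst z) (snd z)) (p, q)"
proof -
  let ?A = "\<lambda>z. (\<Phi> (snd z) - \<Phi> (fst z)) / (snd z - fst z)"
  have \<Phi>: "isCont (\<lambda>z. \<Phi> (snd z)) (p, q)" "isCont (\<lambda>z. \<Phi> (fst z)) (p, q)"
    by (rule isCont_o2[where g = \<Phi>, OF _ DERIV_isCont[OF Phi_deriv]], intro continuous_intros)+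
  have "isCont ?A (p, q)"
    by (intro continuous_intros \<Phi>) (use assms in auto)
  moreover have "?A (p, q) = F (node p q)" using Phi_diff[OF assms] assms by simp
  then have "isCont quantile (?A (p, q))"
    using DERIV_isCont[OF quantile_deriv[OF node_inside[OF assms]]] by (simp only:)
  ultimately have "isCont (\<lambda>z. quantile (?A z)) (p, q)"
    by (rule isCont_o2)
  moreover have "\<forall>\<^sub>F z in nhds (p, q). fst z < snd z"
  proof (rule eventually_nhds_in_open[of "{z. fst z < snd z}", simplified])
    show "open {z. fst z < (snd z :: real)}"
      by (intro open_Collect_less continuous_intros)
  qed (use assms in simp)
  then have "\<forall>\<^sub>F z in nhds (p, q). node (fst z) (snd z) = quantile (?A z)"
    by eventually_elim (simp add: node_def)
  from isCont_cong[OF this] calculation show ?thesis by simp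
qed

lemma weight_isCont:
  assumes "a \<le> p" "p < q" "q \<le> b"
  shows lweight_isCont: "isCont (\<lambda>z. lweight (fst z) (snd z)) (p, q)"
    and rweight_isCont: "isCont (\<lambda>z. rweight (fst z) (snd z)) (p, q)"
proof -
  have c: "node p q \<in> {a<..<b}" by (rule node_inside[OF assms])
  have "isCont (\<lambda>z. F (fst z)) (p, q)" "isCont (\<lambda>z. F (snd z)) (p, q)"
    "isCont (\<lambda>z. F (node (fst z) (snd z))) (p, q)"
    by (rule isCont_o2[where g = F, OF _ cdf_cont], intro continuous_intros node_isCont assms)+
  moreover have "isCont (\<lambda>z. f (node (fst z) (snd z))) (p, q)"
    by (rule isCont_o2[where g = f, OF node_isCont[OF assms]]) (use density_cont[OF c] in simp)
  moreover have "(q - p) * f (node p q) \<noteq> 0"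
    using assms density_pos[OF c] by simp
  ultimately show "isCont (\<lambda>z. lweight (fst z) (snd z)) (p, q)"
    "isCont (\<lambda>z. rweight (fst z) (snd z)) (p, q)"
    unfolding lweight_def rweight_def by (auto intro!: continuous_intros)
qed

text \<open>The segment is cut at time \<tau>. The initial piece stays near \<open>(p, q)\<close>,
  where a better bound \<open>K\<close> is available; on the rest the weights sum to at most 1, so
  the displacement is not enlarged.\<close>

lemma node_path_bound:
  assumes pq: "a \<le> p" "p < q" "q \<le> b" and lr: "a \<le> l" "l \<le> r" "r \<le> b"
    and \<tau>: "0 < \<tau>" "\<tau> \<le> 1"
    and K: "\<And>t u v. u = p + t * (l - p) \<Longrightarrow> v = q + t * (r - q) \<Longrightarrow> 0 \<le> t \<Longrightarrow> t \<le> \<tau> \<Longrightarrow>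
      a \<le> u \<Longrightarrow> u < v \<Longrightarrow> v \<le> b \<Longrightarrow>
      \<bar>lweight u v * (l - p) + rweight u v * (r - q)\<bar> \<le> K"
  shows "\<bar>node l r - node p q\<bar> \<le> \<tau> * K + (1 - \<tau>) * max \<bar>l - p\<bar> \<bar>r - q\<bar>"
proof -
  define w where "w t = node (p + t * (l - p)) (q + t * (r - q))" for t
  obtain z where z: "0 < z" "z < \<tau>" "a \<le> p + z * (l - p)" "p + z * (l - p) < q + z * (r - q)"
    "q + z * (r - q) \<le> b"
    "w \<tau> - w 0 = (\<tau> - 0) * (lweight (p + z * (l - p)) (q + z * (r - q)) * (l - p)
      + rweight (p + z * (l - p)) (q + z * (r - q)) * (r - q))"
    unfolding w_def by (rule node_path_mvt[OF pq lr, of 0 \<tau>]) (use \<tau> in auto)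
  have "\<bar>w \<tau> - w 0\<bar> \<le> \<tau> * K"
    unfolding z(6) abs_mult using \<tau> K[OF refl refl _ _ z(3-5)] z(1,2)
    by (auto intro!: mult_mono)
  moreover have "\<bar>w 1 - w \<tau>\<bar> \<le> (1 - \<tau>) * max \<bar>l - p\<bar> \<bar>r - q\<bar>"
  proof (cases "\<tau> = 1")
    case False
    then have "\<tau> < 1" using \<tau> by simp
    obtain z where z: "\<tau> < z" "z < 1" "a \<le> p + z * (l - p)" "p + z * (l - p) < q + z * (r - q)"
      "q + z * (r - q) \<le> b"
      "w 1 - w \<tau> = (1 - \<tau>) * (lweight (p + z * (l - p)) (q + z * (r - q)) * (l - p)
        + rweight (p + z * (l - p)) (q + z * (r - q)) * (r - q))"
      unfolding w_def by (rule node_path_mvt[OF pq lr, of \<tau> 1]) (use \<tau> \<open>\<tau> < 1\<close> in auto)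
    show ?thesis
      unfolding z(6) abs_mult
      using abs_weighted_sum_le[OF less_imp_le less_imp_le, OF weight_pos[OF z(3-5)] weight_sum_le[OF z(3-5)]] \<tau>
      by (auto intro!: mult_mono)
  qed simp
  moreover have "w 0 = node p q" "w 1 = node l r" by (simp_all add: w_def)
  ultimately show ?thesis by linarith
qed

text \<open>Both partial derivatives are positive along the segment joining the two pairs.\<close>

lemma node_mono:
  assumes "a \<le> l" "l \<le> r" "l' \<le> r'" "l \<le> l'" "r \<le> r'" "r' \<le> b"
  shows "node l r \<le> node l' r'"
proof (cases "l' < r'")
  case True
  obtain z where z: "a \<le> l' + z * (l - l')" "l' + z * (l - l') < r' + z * (r - r')"
    "r' + z * (r - r') \<le> b"
    "node l r - node l' r' = lweight (l' + z * (l - l')) (r' + z * (r - r')) * (l - l')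
      + rweight (l' + z * (l - l')) (r' + z * (r - r')) * (r - r')"
    using node_path_mvt[of l' r' l r 0 1] True assms by auto
  have "node l r - node l' r' \<le> 0"
    unfolding z(4) using weight_pos[OF z(1-3)] assms
    by (intro add_nonpos_nonpos mult_nonneg_nonpos) auto
  then show ?thesis by simp
next
  case False
  then show ?thesis using node_mem[of l r] assms by auto
qed

text \<open>
  The weight \<open>\<theta>\<close> on the smaller displacement lets the vanishing displacement of the end points
  propagate into the interior of the grid.
\<close>

lemma node_averaging:
  assumes pq: "a \<le> p" "p < q" "q \<le> b"
  obtains \<theta> where "0 < \<theta>" "\<theta> \<le> 1"
    "\<And>l r. a \<le> l \<Longrightarrow> l \<le> r \<Longrightarrow> r \<le> b \<Longrightarrow> \<bar>node l r - node p q\<bar>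
      \<le> (1 - \<theta>) * max \<bar>l - p\<bar> \<bar>r - q\<bar> + \<theta> * min \<bar>l - p\<bar> \<bar>r - q\<bar>"
proof -
  \<comment> \<open>Half of the smaller weight leaves room for both weights to stay above \<theta>
    in a neighbourhood of \<open>(p, q)\<close>.\<close>
  define \<theta> where "\<theta> = min (lweight p q) (rweight p q) / 2"
  have pos: "0 < lweight p q" "0 < rweight p q" by (rule weight_pos[OF pq])+
  then have \<theta>: "0 < \<theta>" "\<theta> < lweight p q" "\<theta> < rweight p q"
    by (auto simp: \<theta>_def min_def)
  have "\<theta> \<le> 1" using weight_sum_le[OF pq] \<theta> by linarith
  have "\<forall>\<^sub>F z in nhds (p, q). \<theta> < lweight (fst z) (snd z)"
    by (rule order_tendstoD(1)[OF isCont_tendsto_nhds[OF lweight_isCont[OF pq]]]) (simp add: \<theta>(2))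
  moreover have "\<forall>\<^sub>F z in nhds (p, q). \<theta> < rweight (fst z) (snd z)"
    by (rule order_tendstoD(1)[OF isCont_tendsto_nhds[OF rweight_isCont[OF pq]]]) (simp add: \<theta>(3))
  ultimately have "\<forall>\<^sub>F z in nhds (p, q). \<theta> < lweight (fst z) (snd z) \<and> \<theta> < rweight (fst z) (snd z)"
    by eventually_elim simp
  then obtain \<tau> where \<tau>: "0 < \<tau>" "\<tau> \<le> 1"
    and near: "\<And>l r t. l \<in> {a..b} \<Longrightarrow> r \<in> {a..b} \<Longrightarrow> 0 \<le> t \<Longrightarrow> t \<le> \<tau> \<Longrightarrow>
      \<theta> < lweight (p + t * (l - p)) (q + t * (r - q)) \<and> \<theta> < rweight (p + t * (l - p)) (q + t * (r - q))"
    by (rule eventually_nhds_segment[of _ p q a b]) (use pq a_less_b in auto)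
  show thesis
  \<comment> \<open>The improvement by \<theta> is available on the fraction \<tau> of the
    segment.\<close>
  proof (rule that[of "\<tau> * \<theta>"])
    show "0 < \<tau> * \<theta>" "\<tau> * \<theta> \<le> 1"
      using \<tau> \<theta>(1) \<open>\<theta> \<le> 1\<close> by (auto intro: mult_le_one)
    fix l r assume lr: "a \<le> l" "l \<le> r" "r \<le> b"
    have "\<bar>node l r - node p q\<bar> \<le> \<tau> * ((1 - \<theta>) * max \<bar>l - p\<bar> \<bar>r - q\<bar> + \<theta> * min \<bar>l - p\<bar> \<bar>r - q\<bar>)
        + (1 - \<tau>) * max \<bar>l - p\<bar> \<bar>r - q\<bar>"
    proof (rule node_path_bound[OF pq lr \<tau>])
      fix t u v assume uv: "u = p + t * (l - p)" "v = q + t * (r - q)" "0 \<le> t" "t \<le> \<tau>"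
        "a \<le> u" "u < v" "v \<le> b"
      show "\<bar>lweight u v * (l - p) + rweight u v * (r - q)\<bar>
          \<le> (1 - \<theta>) * max \<bar>l - p\<bar> \<bar>r - q\<bar> + \<theta> * min \<bar>l - p\<bar> \<bar>r - q\<bar>"
        using near[of l r t] lr uv \<theta> weight_sum_le[OF uv(5-7)]
        by (intro abs_weighted_sum_le_max_min) auto
    qed
    also have "\<dots> = (1 - \<tau> * \<theta>) * max \<bar>l - p\<bar> \<bar>r - q\<bar> + \<tau> * \<theta> * min \<bar>l - p\<bar> \<bar>r - q\<bar>"
      by (simp add: algebra_simps)
    finally show "\<bar>node l r - node p q\<bar> \<le> \<dots>" .
  qed
qed

text \<open>In the strict case the partial derivatives at \<open>(p, q)\<close> sum to less than 1,
  hence to less than some \<open>k < 1\<close> nearby. The gain \<open>1 - k\<close> on the initial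
  piece of each segment survives the merely nonexpansive remainder.\<close>

lemma node_contraction:
  assumes pq: "a \<le> p" "p < q" "q \<le> b" and strict: "strictly_log_concave_on {a<..<b} f"
  obtains \<kappa> where "0 \<le> \<kappa>" "\<kappa> < 1"
    "\<And>l r. a \<le> l \<Longrightarrow> l \<le> r \<Longrightarrow> r \<le> b \<Longrightarrow> \<bar>node l r - node p q\<bar> \<le> \<kappa> * max \<bar>l - p\<bar> \<bar>r - q\<bar>"
proof -
  \<comment> \<open>The midpoint between the weight sum at \<open>(p, q)\<close> and 1.\<close>
  define k where "k = (1 + (lweight p q + rweight p q)) / 2"
  have pos: "0 < lweight p q" "0 < rweight p q" by (rule weight_pos[OF pq])+
  have k: "0 \<le> k" "k < 1" "lweight p q + rweight p q < k"
    using weight_sum_less[OF pq strict] pos by (auto simp: k_def)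
  have "\<forall>\<^sub>F z in nhds (p, q). lweight (fst z) (snd z) + rweight (fst z) (snd z) < k"
    by (rule order_tendstoD(2)[OF isCont_tendsto_nhds[OF continuous_add[OF weight_isCont[OF pq]]]])
      (simp add: k(3))
  then obtain \<tau> where \<tau>: "0 < \<tau>" "\<tau> \<le> 1"
    and near: "\<And>l r t. l \<in> {a..b} \<Longrightarrow> r \<in> {a..b} \<Longrightarrow> 0 \<le> t \<Longrightarrow> t \<le> \<tau> \<Longrightarrow>
      lweight (p + t * (l - p)) (q + t * (r - q)) + rweight (p + t * (l - p)) (q + t * (r - q)) < k"
    by (rule eventually_nhds_segment[of _ p q a b]) (use pq a_less_b in auto)
  show thesis
  proof (rule that[of "1 - \<tau> * (1 - k)"])
    show "0 \<le> 1 - \<tau> * (1 - k)" "1 - \<tau> * (1 - k) < 1"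
      using \<tau> k by (auto simp: mult_le_one)
    fix l r assume lr: "a \<le> l" "l \<le> r" "r \<le> b"
    have "\<bar>node l r - node p q\<bar> \<le> \<tau> * (k * max \<bar>l - p\<bar> \<bar>r - q\<bar>) + (1 - \<tau>) * max \<bar>l - p\<bar> \<bar>r - q\<bar>"
    proof (rule node_path_bound[OF pq lr \<tau>])
      fix t u v assume uv: "u = p + t * (l - p)" "v = q + t * (r - q)" "0 \<le> t" "t \<le> \<tau>"
        "a \<le> u" "u < v" "v \<le> b"
      show "\<bar>lweight u v * (l - p) + rweight u v * (r - q)\<bar> \<le> k * max \<bar>l - p\<bar> \<bar>r - q\<bar>"
        using near[of l r t] lr uv weight_pos[OF uv(5-7)]
        by (intro abs_weighted_sum_le) auto
    qed
    also have "\<dots> = (1 - \<tau> * (1 - k)) * max \<bar>l - p\<bar> \<bar>r - q\<bar>"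
      by (simp add: algebra_simps)
    finally show "\<bar>node l r - node p q\<bar> \<le> \<dots>" .
  qed
qed

end

section \<open>Order, maximum norm and uniform constants\<close>

lemma less_by_steps:
  fixes y :: "nat \<Rightarrow> 'a::order"
  assumes step: "\<And>k. m \<le> k \<Longrightarrow> k < n \<Longrightarrow> y k < y (Suc k)" and "m \<le> i" "i < j" "j \<le> n"
  shows "y i < y j"
  using assms(3,4)
proof (induction j)
  case (Suc j)
  then have "y j < y (Suc j)" using \<open>m \<le> i\<close> by (intro step) auto
  then show ?case using Suc by (cases "i = j") auto
qed simp

lemma max_norm_le_iff:
  "3 \<le> N \<Longrightarrow> max_norm N x \<le> D \<longleftrightarrow> (\<forall>i\<in>{2..N-1}. \<bar>x i\<bar> \<le> D)"
  unfolding max_norm_def by (subst Max_le_iff) auto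

lemma abs_le_max_norm: "i \<in> {2..N-1} \<Longrightarrow> \<bar>x i\<bar> \<le> max_norm N x"
  unfolding max_norm_def by (rule Max_ge) auto

text \<open>The minimum of finitely many positive constants is positive; this turns constants found
  node by node into one for the whole grid.\<close>

lemma uniform_lower_bound:
  fixes P :: "'i \<Rightarrow> real \<Rightarrow> bool"
  assumes "finite I" "\<And>i. i \<in> I \<Longrightarrow> \<exists>t. 0 < t \<and> t \<le> 1 \<and> P i t"
    and mono: "\<And>i s t. i \<in> I \<Longrightarrow> 0 < s \<Longrightarrow> s \<le> t \<Longrightarrow> P i t \<Longrightarrow> P i s"
  shows "\<exists>t. 0 < t \<and> t \<le> 1 \<and> (\<forall>i\<in>I. P i t)"
proof -
  obtain t where t: "\<And>i. i \<in> I \<Longrightarrow> 0 < t i \<and> t i \<le> 1 \<and> P i (t i)"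
    using assms(2) by metis
  define m where "m = Min (insert 1 (t ` I))"
  have "0 < m" "m \<le> 1" using assms(1) t by (auto simp: m_def)
  moreover have "P i m" if "i \<in> I" for i
    using assms(1) t[OF that] that \<open>0 < m\<close> by (intro mono[of i m "t i"]) (auto simp: m_def)
  ultimately show ?thesis by blast
qed

section \<open>The fixed-point iteration\<close>

locale dual_grid = log_concave_cdf +
  fixes N :: nat
  assumes N_ge_3: "3 \<le> N"
begin

abbreviation ends :: "(nat \<Rightarrow> real) \<Rightarrow> nat \<Rightarrow> real" where
  "ends \<equiv> with_endpoints a b N"

abbreviation grids :: "(nat \<Rightarrow> real) set" where
  "grids \<equiv> closed_ordered_simplex a b N"

text \<open>The map \<open>T\<close> in terms of \<open>node\<close>, free of the measure. It agrees
  with \<open>grid_map\<close> on the closed simplex by \<open>grid_map_eq_sweep\<close>.\<close>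

definition sweep :: "(nat \<Rightarrow> real) \<Rightarrow> nat \<Rightarrow> real" where
  "sweep x = (\<lambda>i\<in>{2..N-1}. node (ends x (i - 1)) (ends x (i + 1)))"

lemma ends_simps [simp]:
  "ends x N = b" "ends x 1 = a" "ends x (Suc 0) = a"
  "i \<in> {2..N-1} \<Longrightarrow> ends x i = x i"
  using N_ge_3 by (auto simp: with_endpoints_def)

lemma ends_mem: "x \<in> grids \<Longrightarrow> i \<in> {1..N} \<Longrightarrow> ends x i \<in> {a..b}"
  using a_less_b by (auto simp: closed_ordered_simplex_def with_endpoints_def PiE_iff)

lemma ends_mono:
  assumes x: "x \<in> grids" and ij: "1 \<le> i" "i \<le> j" "j \<le> N"
  shows "ends x i \<le> ends x j"
proof -
  consider "i = 1" | "j = N" | "i \<in> {2..N-1}" "j \<in> {2..N-1}" using ij by force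
  then show ?thesis
  proof cases
    case 3
    then have "x i \<le> x j"
      using x ij(2) unfolding closed_ordered_simplex_def mono_on_def by blast
    then show ?thesis using 3 by simp
  qed (use ends_mem[OF x, of i] ends_mem[OF x, of j] ij in auto)
qed

lemma simplexI:
  assumes "x \<in> extensional {2..N-1}"
    and "\<And>i. i \<in> {2..N-1} \<Longrightarrow> x i \<in> {a..b}"
    and "\<And>i j. 2 \<le> i \<Longrightarrow> i \<le> j \<Longrightarrow> j \<le> N - 1 \<Longrightarrow> x i \<le> x j"
  shows "x \<in> grids"
  using assms unfolding closed_ordered_simplex_def mono_on_def PiE_def by auto

lemma sweep_apply: "i \<in> {2..N-1} \<Longrightarrow> sweep x i = node (ends x (i - 1)) (ends x (i + 1))"
  by (simp add: sweep_def)

lemma neighbours: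
  assumes "x \<in> grids" "i \<in> {2..N-1}"
  shows "a \<le> ends x (i - 1)" "ends x (i - 1) \<le> ends x i" "ends x i \<le> ends x (i + 1)" "ends x (i + 1) \<le> b"
proof -
  have "i - 1 \<in> {1..N}" "i + 1 \<in> {1..N}" using assms(2) by auto
  then show "a \<le> ends x (i - 1)" "ends x (i + 1) \<le> b"
    using ends_mem[OF assms(1)] by auto
  show "ends x (i - 1) \<le> ends x i" "ends x i \<le> ends x (i + 1)"
    using assms(2) by (auto intro!: ends_mono[OF assms(1)] simp del: ends_simps)
qed

text \<open>Order is preserved because \<open>node\<close> is monotone in both arguments.\<close>

lemma sweep_closed: "sweep x \<in> grids" if x: "x \<in> grids"
proof (rule simplexI)
  fix i assume i: "i \<in> {2..N-1}"
  show "sweep x i \<in> {a..b}"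
    using node_mem[of "ends x (i - 1)" "ends x (i + 1)"] neighbours[OF x i] i
    by (auto simp: sweep_apply)
next
  fix i j assume ij: "2 \<le> i" "i \<le> j" "j \<le> N - 1"
  have "node (ends x (i - 1)) (ends x (i + 1)) \<le> node (ends x (j - 1)) (ends x (j + 1))"
    using neighbours[OF x, of i] neighbours[OF x, of j] ij
    by (intro node_mono ends_mono[OF x]) auto
  then show "sweep x i \<le> sweep x j" using ij by (simp add: sweep_apply)
qed (simp add: sweep_def)

lemma funpow_sweep_closed: "x \<in> grids \<Longrightarrow> (sweep ^^ l) x \<in> grids"
  by (induction l) (auto intro: sweep_closed)

text \<open>A strict gap of a fixed point forces strict gaps on both sides of it.\<close>

lemma fixed_point_strict:
  assumes x: "x \<in> grids" and fixed: "sweep x = x" and ij: "1 \<le> i" "i < j" "j \<le> N"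
  shows "ends x i < ends x j"
proof -
  have mid: "ends x (k - 1) < ends x (k + 1) \<Longrightarrow> ends x (k - 1) < ends x k \<and> ends x k < ends x (k + 1)"
    if k: "k \<in> {2..N-1}" for k
    using node_between[of "ends x (k - 1)" "ends x (k + 1)"] neighbours[OF x k] k fixed
    by (metis ends_simps(4) sweep_apply)
  have up: "ends x (Suc k) < ends x (Suc (Suc k))"
    if "ends x k < ends x (Suc k)" "1 \<le> k" "Suc k < N" for k
  proof -
    have k: "Suc k \<in> {2..N-1}" using that by auto
    show ?thesis using mid[OF k] neighbours(3)[OF x k] that(1) by (simp del: ends_simps)
  qed
  have down: "ends x k < ends x (Suc k)"
    if "ends x (Suc k) < ends x (Suc (Suc k))" "1 \<le> k" "Suc k < N" for k
  proof -
    have k: "Suc k \<in> {2..N-1}" using that by auto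
    show ?thesis using mid[OF k] neighbours(2)[OF x k] that(1) by (simp del: ends_simps)
  qed
  \<comment> \<open>Without any strict gap the points would never leave \<open>a\<close>, although
    the last one is \<open>b\<close>. This gap then spreads by \<open>up\<close> and
    \<open>down\<close>.\<close>
  have "\<exists>k. 1 \<le> k \<and> k < N \<and> ends x k < ends x (Suc k)"
  proof (rule ccontr)
    assume *: "\<not> ?thesis"
    have "ends x m \<le> a" if "1 \<le> m" "m \<le> N" for m
      using that
    proof (induction m rule: dec_induct)
      case (step m)
      then show ?case using * by (force simp: not_less)
    qed simp
    from this[of N] show False using N_ge_3 a_less_b by simp
  qed
  then obtain k where k: "1 \<le> k" "k < N" "ends x k < ends x (Suc k)" by blast
  have upper: "ends x m < ends x (Suc m)" if "k \<le> m" "m < N" for m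
    using that k
  proof (induction m rule: dec_induct)
    case (step m)
    then show ?case using up[of m] by simp
  qed simp
  have lower: "ends x m < ends x (Suc m)" if "1 \<le> m" "m \<le> k" for m
    using that(2,1)
  proof (induction m rule: inc_induct)
    case (step m)
    then show ?case using down[of m] k by simp
  qed (use k in simp)
  have "ends x m < ends x (Suc m)" if "1 \<le> m" "m < N" for m
    using upper lower that by (cases "k \<le> m") auto
  then show ?thesis using ij by (rule less_by_steps)
qed

lemma fixed_point_ordered:
  assumes x: "x \<in> grids" and fixed: "sweep x = x"
  shows "x \<in> ordered_simplex a b N"
proof -
  have "x i < x j" if "2 \<le> i" "i < j" "j \<le> N - 1" for i j
    using fixed_point_strict[OF assms, of i j] that by auto
  moreover have "x i \<in> {a<..<b}" if "i \<in> {2..N-1}" for i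
    using fixed_point_strict[OF assms, of 1 i] fixed_point_strict[OF assms, of i N] that by auto
  moreover have "x \<in> extensional {2..N-1}"
    using x by (auto simp: closed_ordered_simplex_def PiE_def)
  ultimately show ?thesis
    by (auto simp: ordered_simplex_def PiE_def strict_mono_on_def)
qed

lemma ends_dist_le_max_norm:
  assumes "i \<in> {1..N}"
  shows "\<bar>ends x i - ends y i\<bar> \<le> max_norm N (\<lambda>i. x i - y i)"
proof -
  have "2 \<in> {2..N-1}" using N_ge_3 by auto
  from order_trans[OF abs_ge_zero abs_le_max_norm[OF this]]
  have nonneg: "0 \<le> max_norm N (\<lambda>i. x i - y i)" .
  consider "i = 1" | "i = N" | "i \<in> {2..N-1}" using assms by force
  then show ?thesis
  proof cases
    case 3
    then show ?thesis using abs_le_max_norm[of i N "\<lambda>i. x i - y i"] by simp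
  qed (use nonneg in simp_all)
qed

text \<open>A fixed point has strict gaps, so \<open>node_averaging\<close> applies at the
  neighbours of each node.\<close>

lemma fixed_point_averaging:
  assumes x: "x \<in> grids" and fixed: "sweep x = x"
  obtains \<theta> where "0 < \<theta>" "\<theta> \<le> 1"
    "\<And>y i. y \<in> grids \<Longrightarrow> i \<in> {2..N-1} \<Longrightarrow> \<bar>ends (sweep y) i - ends x i\<bar>
      \<le> (1 - \<theta>) * max \<bar>ends y (i - 1) - ends x (i - 1)\<bar> \<bar>ends y (i + 1) - ends x (i + 1)\<bar>
        + \<theta> * min \<bar>ends y (i - 1) - ends x (i - 1)\<bar> \<bar>ends y (i + 1) - ends x (i + 1)\<bar>"
proof -
  define P where "P i \<theta> \<longleftrightarrow> (\<forall>y\<in>grids. \<bar>ends (sweep y) i - ends x i\<bar>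
      \<le> (1 - \<theta>) * max \<bar>ends y (i - 1) - ends x (i - 1)\<bar> \<bar>ends y (i + 1) - ends x (i + 1)\<bar>
        + \<theta> * min \<bar>ends y (i - 1) - ends x (i - 1)\<bar> \<bar>ends y (i + 1) - ends x (i + 1)\<bar>)" for i \<theta>
  have "\<exists>\<theta>. 0 < \<theta> \<and> \<theta> \<le> 1 \<and> (\<forall>i\<in>{2..N-1}. P i \<theta>)"
  proof (rule uniform_lower_bound)
    fix i assume i: "i \<in> {2..N-1}"
    have lt: "ends x (i - 1) < ends x (i + 1)"
      using fixed_point_strict[OF assms, of "i - 1" "i + 1"] i by auto
    have xi: "ends x i = node (ends x (i - 1)) (ends x (i + 1))"
      using i fixed by (metis ends_simps(4) sweep_apply)
    show "\<exists>\<theta>. 0 < \<theta> \<and> \<theta> \<le> 1 \<and> P i \<theta>"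
    proof (rule node_averaging[OF neighbours(1)[OF x i] lt neighbours(4)[OF x i]])
      fix \<theta> assume "0 < \<theta>" "\<theta> \<le> 1"
        and *: "\<And>l r. a \<le> l \<Longrightarrow> l \<le> r \<Longrightarrow> r \<le> b \<Longrightarrow> \<bar>node l r - node (ends x (i - 1)) (ends x (i + 1))\<bar>
          \<le> (1 - \<theta>) * max \<bar>l - ends x (i - 1)\<bar> \<bar>r - ends x (i + 1)\<bar>
            + \<theta> * min \<bar>l - ends x (i - 1)\<bar> \<bar>r - ends x (i + 1)\<bar>"
      have "P i \<theta>"
        unfolding P_def
      proof
        fix y assume y: "y \<in> grids"
        have swp: "ends (sweep y) i = node (ends y (i - 1)) (ends y (i + 1))"
          using i by (simp add: sweep_apply)
        show "\<bar>ends (sweep y) i - ends x i\<bar>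
          \<le> (1 - \<theta>) * max \<bar>ends y (i - 1) - ends x (i - 1)\<bar> \<bar>ends y (i + 1) - ends x (i + 1)\<bar>
            + \<theta> * min \<bar>ends y (i - 1) - ends x (i - 1)\<bar> \<bar>ends y (i + 1) - ends x (i + 1)\<bar>"
          unfolding xi swp by (rule *) (use neighbours[OF y i] in auto)
      qed
      with \<open>0 < \<theta>\<close> \<open>\<theta> \<le> 1\<close> show ?thesis by blast
    qed
  next
    fix i s t assume "s \<le> t" "P i t" and "0 < (s::real)"
    \<comment> \<open>Moving weight from the minimum to the maximum weakens the bound, so \<theta>
      may be decreased to a common value.\<close>
    have mono: "(1 - t) * max u v + t * min u v \<le> (1 - s) * max u v + s * min u v" for u v :: real
      using mult_right_mono[OF \<open>s \<le> t\<close>, of "max u v - min u v"] by (simp add: algebra_simps)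
    show "P i s"
      using \<open>P i t\<close> unfolding P_def by (blast intro: order_trans[OF _ mono])
  qed simp
  then show thesis using that unfolding P_def by blast
qed

lemma fixed_point_contraction:
  assumes x: "x \<in> grids" and fixed: "sweep x = x" and strict: "strictly_log_concave_on {a<..<b} f"
  obtains \<kappa> where "0 \<le> \<kappa>" "\<kappa> < 1"
    "\<And>y i. y \<in> grids \<Longrightarrow> i \<in> {2..N-1} \<Longrightarrow> \<bar>ends (sweep y) i - ends x i\<bar>
      \<le> \<kappa> * max \<bar>ends y (i - 1) - ends x (i - 1)\<bar> \<bar>ends y (i + 1) - ends x (i + 1)\<bar>"
proof -
  \<comment> \<open>The factor is written as \<open>1 - \<epsilon>\<close> so that the worst factor
    over all nodes comes from \<open>uniform_lower_bound\<close>.\<close>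
  define P where "P i \<epsilon> \<longleftrightarrow> (\<forall>y\<in>grids. \<bar>ends (sweep y) i - ends x i\<bar>
      \<le> (1 - \<epsilon>) * max \<bar>ends y (i - 1) - ends x (i - 1)\<bar> \<bar>ends y (i + 1) - ends x (i + 1)\<bar>)" for i \<epsilon>
  have "\<exists>\<epsilon>. 0 < \<epsilon> \<and> \<epsilon> \<le> 1 \<and> (\<forall>i\<in>{2..N-1}. P i \<epsilon>)"
  proof (rule uniform_lower_bound)
    fix i assume i: "i \<in> {2..N-1}"
    have lt: "ends x (i - 1) < ends x (i + 1)"
      using fixed_point_strict[OF x fixed, of "i - 1" "i + 1"] i by auto
    have xi: "ends x i = node (ends x (i - 1)) (ends x (i + 1))"
      using i fixed by (metis ends_simps(4) sweep_apply)
    show "\<exists>\<epsilon>. 0 < \<epsilon> \<and> \<epsilon> \<le> 1 \<and> P i \<epsilon>"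
    proof (rule node_contraction[OF neighbours(1)[OF x i] lt neighbours(4)[OF x i] strict])
      fix \<kappa> :: real assume \<kappa>: "0 \<le> \<kappa>" "\<kappa> < 1"
        and *: "\<And>l r. a \<le> l \<Longrightarrow> l \<le> r \<Longrightarrow> r \<le> b \<Longrightarrow> \<bar>node l r - node (ends x (i - 1)) (ends x (i + 1))\<bar>
          \<le> \<kappa> * max \<bar>l - ends x (i - 1)\<bar> \<bar>r - ends x (i + 1)\<bar>"
      have "P i (1 - \<kappa>)"
        unfolding P_def
      proof
        fix y assume y: "y \<in> grids"
        have swp: "ends (sweep y) i = node (ends y (i - 1)) (ends y (i + 1))"
          using i by (simp add: sweep_apply)
        have compl: "1 - (1 - \<kappa>) = \<kappa>" by simp
        show "\<bar>ends (sweep y) i - ends x i\<bar>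
          \<le> (1 - (1 - \<kappa>)) * max \<bar>ends y (i - 1) - ends x (i - 1)\<bar> \<bar>ends y (i + 1) - ends x (i + 1)\<bar>"
          unfolding xi swp compl by (rule *) (use neighbours[OF y i] in auto)
      qed
      with \<kappa> show ?thesis by (intro exI[of _ "1 - \<kappa>"]) auto
    qed
  next
    fix i s t assume "s \<le> t" "P i t" and "0 < (s::real)"
    have mono: "(1 - t) * max \<bar>u\<bar> \<bar>v\<bar> \<le> (1 - s) * max \<bar>u\<bar> \<bar>v\<bar>" for u v :: real
      using \<open>s \<le> t\<close> by (intro mult_right_mono) auto
    show "P i s"
      using \<open>P i t\<close> unfolding P_def by (blast intro: order_trans[OF _ mono])
  qed simp
  then obtain \<epsilon> where \<epsilon>: "0 < \<epsilon>" "\<epsilon> \<le> 1" "\<forall>i\<in>{2..N-1}. P i \<epsilon>" by blast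
  show thesis by (rule that[of "1 - \<epsilon>"]) (use \<epsilon> in \<open>auto simp: P_def\<close>)
qed

lemma sweep_linear_convergence:
  assumes x: "x \<in> grids" and fixed: "sweep x = x" and strict: "strictly_log_concave_on {a<..<b} f"
  obtains \<rho> where "0 \<le> \<rho>" "\<rho> < 1"
    "\<And>y l. y \<in> grids \<Longrightarrow>
      max_norm N (\<lambda>i. (sweep ^^ l) y i - x i) \<le> max_norm N (\<lambda>i. y i - x i) * \<rho> ^ l"
proof -
  obtain \<kappa> where \<kappa>: "0 \<le> \<kappa>" "\<kappa> < 1"
    and step: "\<And>y i. y \<in> grids \<Longrightarrow> i \<in> {2..N-1} \<Longrightarrow> \<bar>ends (sweep y) i - ends x i\<bar>
      \<le> \<kappa> * max \<bar>ends y (i - 1) - ends x (i - 1)\<bar> \<bar>ends y (i + 1) - ends x (i + 1)\<bar>"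
    using fixed_point_contraction[OF assms] by blast
  have one: "max_norm N (\<lambda>i. sweep y i - x i) \<le> \<kappa> * max_norm N (\<lambda>i. y i - x i)" if "y \<in> grids" for y
    unfolding max_norm_le_iff[OF N_ge_3]
  proof
    fix i assume i: "i \<in> {2..N-1}"
    have "max \<bar>ends y (i - 1) - ends x (i - 1)\<bar> \<bar>ends y (i + 1) - ends x (i + 1)\<bar>
        \<le> max_norm N (\<lambda>i. y i - x i)"
      using i by (intro max.boundedI ends_dist_le_max_norm) auto
    from order_trans[OF step[OF that i] mult_left_mono[OF this \<kappa>(1)]]
    show "\<bar>sweep y i - x i\<bar> \<le> \<kappa> * max_norm N (\<lambda>i. y i - x i)"
      unfolding ends_simps(4)[OF i] .
  qed
  have "max_norm N (\<lambda>i. (sweep ^^ l) y i - x i) \<le> max_norm N (\<lambda>i. y i - x i) * \<kappa> ^ l"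
    if "y \<in> grids" for y l
  proof (induction l)
    case (Suc l)
    have "max_norm N (\<lambda>i. (sweep ^^ Suc l) y i - x i) \<le> \<kappa> * max_norm N (\<lambda>i. (sweep ^^ l) y i - x i)"
      using one[OF funpow_sweep_closed[OF that]] by simp
    also have "\<dots> \<le> \<kappa> * (max_norm N (\<lambda>i. y i - x i) * \<kappa> ^ l)"
      using Suc \<kappa> by (intro mult_left_mono)
    finally show ?case by (simp add: ac_simps)
  qed simp
  with \<kappa> show thesis by (rule that)
qed

text \<open>The displacement vanishes at both ends, and each step carries part of this one index
  further inwards. A block is the number of steps after which every index has been reached.\<close>

lemma sweep_blockwise_convergence:
  assumes x: "x \<in> grids" and fixed: "sweep x = x"
  obtains \<rho> where "0 \<le> \<rho>" "\<rho> < 1"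
    "\<And>y l. y \<in> grids \<Longrightarrow> max_norm N (\<lambda>i. (sweep ^^ l) y i - x i)
      \<le> max_norm N (\<lambda>i. y i - x i) * \<rho> ^ (l div ((N - 1) div 2))"
proof -
  obtain \<theta> where \<theta>: "0 < \<theta>" "\<theta> \<le> 1"
    and step: "\<And>y i. y \<in> grids \<Longrightarrow> i \<in> {2..N-1} \<Longrightarrow> \<bar>ends (sweep y) i - ends x i\<bar>
      \<le> (1 - \<theta>) * max \<bar>ends y (i - 1) - ends x (i - 1)\<bar> \<bar>ends y (i + 1) - ends x (i + 1)\<bar>
        + \<theta> * min \<bar>ends y (i - 1) - ends x (i - 1)\<bar> \<bar>ends y (i + 1) - ends x (i + 1)\<bar>"
    using fixed_point_averaging[OF assms] by blast
  \<comment> \<open>This is \<open>\<lceil>N / 2\<rceil> - 1\<close>, see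
    \<open>floor_block_index\<close>.\<close>
  define K where "K = (N - 1) div 2"
  have K: "0 < K" using N_ge_3 by (simp add: K_def)
  define d where "d y i = \<bar>ends y i - ends x i\<bar>" for y i
  have d_end: "d y 1 = 0" "d y N = 0" for y by (simp_all add: d_def)
  have d_nonneg: "0 \<le> d y i" for y i by (simp add: d_def)
  have avg: "d (sweep y) i \<le> (1 - \<theta>) * D + \<theta> * D'"
    if "y \<in> grids" "i \<in> {2..N-1}" "d y (i - 1) \<le> D" "d y (i + 1) \<le> D"
      "d y (i - 1) \<le> D' \<or> d y (i + 1) \<le> D'" for y i D D'
  proof -
    have "(1 - \<theta>) * max (d y (i - 1)) (d y (i + 1)) + \<theta> * min (d y (i - 1)) (d y (i + 1))
        \<le> (1 - \<theta>) * D + \<theta> * D'"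
      using that(3-5) \<theta> by (intro add_mono mult_left_mono) auto
    then show ?thesis using step[OF that(1,2)] unfolding d_def by linarith
  qed
  have bound: "d ((sweep ^^ k) y) i \<le> D"
    if y: "y \<in> grids" and D: "\<And>i. i \<in> {1..N} \<Longrightarrow> d y i \<le> D" and i: "i \<in> {1..N}" for y k i D
    using i
  proof (induction k arbitrary: i)
    case (Suc k)
    have "0 \<le> D" using D[of 1] d_nonneg[of y 1] N_ge_3 by simp
    consider "i = 1" | "i = N" | "i \<in> {2..N-1}" using Suc.prems by force
    then show ?case
    proof cases
      case 3
      have "d (sweep ((sweep ^^ k) y)) i \<le> (1 - \<theta>) * D + \<theta> * D"
        using 3 by (intro avg funpow_sweep_closed y disjI1 Suc.IH) auto
      then show ?thesis by (simp add: algebra_simps)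
    qed (use d_end \<open>0 \<le> D\<close> in auto)
  qed (use D in simp)
  \<comment> \<open>After \<open>k\<close> steps the gain \<open>\<theta> ^ k\<close> holds at all
    indices within distance \<open>k\<close> of an end. The neighbour closer to that end supplies
    the smaller bound, and \<open>(1 - \<theta>) * D + \<theta> * ((1 - \<theta> ^ k) * D)\<close>
    is the bound with exponent \<open>k + 1\<close>.\<close>
  have decay: "d ((sweep ^^ k) y) i \<le> (1 - \<theta> ^ k) * D"
    if y: "y \<in> grids" and D: "\<And>i. i \<in> {1..N} \<Longrightarrow> d y i \<le> D" and i: "i \<in> {1..N}" "i \<le> k + 1 \<or> N \<le> i + k"
    for y k i D
    using i
  proof (induction k arbitrary: i)
    case 0
    then have "i = 1 \<or> i = N" by auto
    then show ?case using d_end by auto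
  next
    case (Suc k)
    have "0 \<le> D" using D[of 1] d_nonneg[of y 1] N_ge_3 by simp
    moreover have "\<theta> ^ Suc k \<le> 1" using \<theta> by (intro power_le_one) auto
    ultimately have nonneg: "0 \<le> (1 - \<theta> ^ Suc k) * D" by simp
    consider "i = 1" | "i = N" | "i \<in> {2..N-1}" using Suc.prems by force
    then show ?case
    proof cases
      case 3
      have near: "d ((sweep ^^ k) y) (i - 1) \<le> (1 - \<theta> ^ k) * D \<or> d ((sweep ^^ k) y) (i + 1) \<le> (1 - \<theta> ^ k) * D"
        using Suc.IH[of "i - 1"] Suc.IH[of "i + 1"] Suc.prems 3 by force
      have "d (sweep ((sweep ^^ k) y)) i \<le> (1 - \<theta>) * D + \<theta> * ((1 - \<theta> ^ k) * D)"
        using 3 near by (intro avg funpow_sweep_closed y bound D) auto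
      then show ?thesis by (simp add: algebra_simps)
    qed (use d_end nonneg in auto)
  qed
  define \<rho> where "\<rho> = 1 - \<theta> ^ K"
  have \<rho>: "0 \<le> \<rho>" "\<rho> < 1"
    using \<theta> power_le_one[of \<theta> K] by (auto simp: \<rho>_def)
  have block: "max_norm N (\<lambda>i. (sweep ^^ K) y i - x i) \<le> \<rho> * max_norm N (\<lambda>i. y i - x i)"
    if y: "y \<in> grids" for y
    unfolding max_norm_le_iff[OF N_ge_3]
  proof
    fix i assume i: "i \<in> {2..N-1}"
    \<comment> \<open>Since \<open>2 * K\<close> is at least \<open>N - 2\<close>, each index is
      within distance \<open>K\<close> of one of the ends.\<close>
    then have "i \<in> {1..N}" "i \<le> K + 1 \<or> N \<le> i + K" by (auto simp: K_def)
    from decay[OF y _ this, of "max_norm N (\<lambda>i. y i - x i)"]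
    show "\<bar>(sweep ^^ K) y i - x i\<bar> \<le> \<rho> * max_norm N (\<lambda>i. y i - x i)"
      using ends_dist_le_max_norm[of _ y x] i by (simp add: d_def \<rho>_def)
  qed
  have nonexp: "max_norm N (\<lambda>i. (sweep ^^ k) y i - x i) \<le> max_norm N (\<lambda>i. y i - x i)"
    if y: "y \<in> grids" for y k
    unfolding max_norm_le_iff[OF N_ge_3]
  proof
    fix i assume i: "i \<in> {2..N-1}"
    then have "i \<in> {1..N}" by auto
    from bound[OF y _ this, of "max_norm N (\<lambda>i. y i - x i)" k]
    show "\<bar>(sweep ^^ k) y i - x i\<bar> \<le> max_norm N (\<lambda>i. y i - x i)"
      using ends_dist_le_max_norm[of _ y x] i by (simp add: d_def)
  qed
  have blocks: "max_norm N (\<lambda>i. (sweep ^^ (K * j)) y i - x i) \<le> max_norm N (\<lambda>i. y i - x i) * \<rho> ^ j"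
    if y: "y \<in> grids" for y j
  proof (induction j)
    case (Suc j)
    have "max_norm N (\<lambda>i. (sweep ^^ (K * Suc j)) y i - x i) \<le> \<rho> * max_norm N (\<lambda>i. (sweep ^^ (K * j)) y i - x i)"
      using block[OF funpow_sweep_closed[OF y, of "K * j"]] by (simp add: funpow_add)
    also have "\<dots> \<le> \<rho> * (max_norm N (\<lambda>i. y i - x i) * \<rho> ^ j)"
      using Suc \<rho>(1) by (intro mult_left_mono)
    finally show ?case by (simp add: ac_simps)
  qed simp
  have "max_norm N (\<lambda>i. (sweep ^^ l) y i - x i) \<le> max_norm N (\<lambda>i. y i - x i) * \<rho> ^ (l div K)"
    if y: "y \<in> grids" for y l
  proof -
    \<comment> \<open>The steps left over after the complete blocks do not increase the
      distance.\<close>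
    have "sweep ^^ l = sweep ^^ (l mod K) \<circ> sweep ^^ (K * (l div K))"
      by (metis funpow_add mod_mult_div_eq)
    then show ?thesis
      using nonexp[OF funpow_sweep_closed[OF y, of "K * (l div K)"], of "l mod K"] blocks[OF y, of "l div K"]
      by simp
  qed
  with \<rho> show thesis unfolding K_def by (rule that)
qed

text \<open>One block shrinks the distance to \<open>x\<close> by a factor below 1, yet leaves
  another fixed point where it is; so that distance is 0.\<close>

lemma fixed_point_unique:
  assumes x: "x \<in> grids" "sweep x = x" and y: "y \<in> grids" "sweep y = y"
  shows "y = x"
proof -
  obtain \<rho> where \<rho>: "0 \<le> \<rho>" "\<rho> < 1" and conv: "\<And>y l. y \<in> grids \<Longrightarrow> max_norm N (\<lambda>i. (sweep ^^ l) y i - x i)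
      \<le> max_norm N (\<lambda>i. y i - x i) * \<rho> ^ (l div ((N - 1) div 2))"
    using sweep_blockwise_convergence[OF x] by blast
  have "(sweep ^^ l) y = y" for l by (induction l) (auto simp: y(2))
  with conv[OF y(1), of "(N - 1) div 2"] N_ge_3
  have le: "max_norm N (\<lambda>i. y i - x i) \<le> max_norm N (\<lambda>i. y i - x i) * \<rho>" by simp
  have "max_norm N (\<lambda>i. y i - x i) \<le> 0"
  proof (rule ccontr)
    assume "\<not> ?thesis"
    then have "max_norm N (\<lambda>i. y i - x i) * \<rho> < max_norm N (\<lambda>i. y i - x i) * 1"
      using \<rho>(2) by (intro mult_strict_left_mono) auto
    with le show False by simp
  qed
  then have "\<forall>i\<in>{2..N-1}. y i = x i"
    unfolding max_norm_le_iff[OF N_ge_3] by simp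
  then show ?thesis
    using x(1) y(1) unfolding closed_ordered_simplex_def by (auto intro: PiE_ext)
qed

end

section \<open>Compactness of the simplex, and a splitting of sums\<close>

lemma compact_closed_ordered_simplex: "compact (closed_ordered_simplex a b N)"
proof -
  \<comment> \<open>Coordinates outside the index set are confined to the single value
    \<open>undefined\<close>, so the extensional vectors form a product of compact sets and
    Tychonoff's theorem applies.\<close>
  let ?I = "{2..N-1}" and ?X = "\<lambda>i. if i \<in> {2..N-1} then {a..b} else {undefined}"
  have "compactin (product_topology (\<lambda>_. euclidean) UNIV) (PiE UNIV ?X)"
    by (subst compactin_PiE) auto
  then have compact: "compact (PiE UNIV ?X)"
    by (simp add: euclidean_product_topology)
  have "closed (\<Inter>i\<in>?I. \<Inter>j\<in>{j \<in> ?I. i \<le> j}. {x :: nat \<Rightarrow> real. x i \<le> x j})"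
    by (intro closed_INT ballI closed_Collect_le continuous_on_product_coordinates)
  also have "(\<Inter>i\<in>?I. \<Inter>j\<in>{j \<in> ?I. i \<le> j}. {x :: nat \<Rightarrow> real. x i \<le> x j}) = {x. mono_on ?I x}"
    by (auto simp: mono_on_def)
  finally have "closed {x :: nat \<Rightarrow> real. mono_on ?I x}" .
  from compact_Int_closed[OF compact this]
  have "compact (PiE UNIV ?X \<inter> {x. mono_on ?I x})" .
  also have "PiE UNIV ?X \<inter> {x. mono_on ?I x} = closed_ordered_simplex a b N"
    unfolding closed_ordered_simplex_def by (auto simp: PiE_iff extensional_def split: if_splits)
  finally show ?thesis .
qed

text \<open>Isolates the two cells that meet at node \<open>i\<close>.\<close>

lemma sum_remove2:
  fixes g :: "nat \<Rightarrow> 'a::comm_monoid_add"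
  assumes "2 \<le> i" "i < N"
  shows "sum g {1..<N} = g (i - 1) + g i + sum g ({1..<N} - {i - 1, i})"
proof -
  have "{1..<N} = insert (i - 1) (insert i ({1..<N} - {i - 1, i}))" using assms by auto
  then have "sum g {1..<N} = sum g (insert (i - 1) (insert i ({1..<N} - {i - 1, i})))" by simp
  also have "\<dots> = g (i - 1) + (g i + sum g ({1..<N} - {i - 1, i}))"
    using assms by (subst sum.insert; (subst sum.insert)?) auto
  finally show ?thesis by (simp add: ac_simps)
qed

context log_concave_cdf
begin

section \<open>The distortion as a trapezoidal error\<close>

text \<open>
  The contribution \<open>\<integral>\<^bsub>u\<^esub>\<^bsup>v\<^esup> (\<xi> - u) (v - \<xi>) \<mu>(d\<xi>)\<close> of one cell to the distortion, after integrating
  by parts twice. Up to a constant, the distortion of a grid is thus twice the trapezoidal rule for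
  the convex function \<open>\<Phi>\<close>.
\<close>

definition cell :: "real \<Rightarrow> real \<Rightarrow> real" where
  "cell u v = (v - u) * (\<Phi> v + \<Phi> u) - 2 * (\<Psi> v - \<Psi> u)"

lemma cell_refl [simp]: "cell u u = 0"
  by (simp add: cell_def)

lemma Phi_strict_convex:
  assumes "c \<in> {a..b}" "t \<in> {a..b}" "t \<noteq> c"
  shows "F c * (t - c) < \<Phi> t - \<Phi> c"
proof -
  obtain z where z: "min c t < z" "z < max c t" "\<Phi> t - \<Phi> c = (t - c) * F z"
    using mvt_unordered[of c t \<Phi> F] Phi_deriv assms(3) by metis
  have "0 < (t - c) * (F z - F c)"
  proof (cases "c < t")
    case True
    then show ?thesis using z assms by (auto simp: min_def max_def intro!: mult_pos_pos cdf_strict_mono)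
  next
    case False
    then show ?thesis
      using z assms by (intro mult_neg_neg) (auto simp: min_def max_def intro!: cdf_strict_mono split: if_splits)
  qed
  then show ?thesis using z(3) by (simp add: algebra_simps)
qed

text \<open>The \<Psi> terms telescope, so \<open>t\<close> enters only through
  \<open>(r - l) * \<Phi> t - (\<Phi> r - \<Phi> l) * t\<close>. This is strictly convex on
  \<open>[a, b]\<close>, and its derivative vanishes at the node.\<close>

lemma cell_node_less:
  assumes "a \<le> l" "l < r" "r \<le> b" "t \<in> {l..r}" "t \<noteq> node l r"
  shows "cell l (node l r) + cell (node l r) r < cell l t + cell t r"
proof -
  let ?c = "node l r"
  have "cell l t + cell t r - (cell l ?c + cell ?c r)
      = (r - l) * (\<Phi> t - \<Phi> ?c) - (\<Phi> r - \<Phi> l) * (t - ?c)"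
    unfolding cell_def by algebra
  also have "\<dots> = (r - l) * (\<Phi> t - \<Phi> ?c - F ?c * (t - ?c))"
    unfolding Phi_diff[OF assms(1-3)] by algebra
  also have "\<dots> > 0"
    using Phi_strict_convex[of ?c t] node_inside[OF assms(1-3)] assms by simp
  finally show ?thesis by simp
qed

lemma Phi_pos: "a < x \<Longrightarrow> 0 < \<Phi> x"
proof -
  assume x: "a < x"
  obtain z where z: "a < z" "z < x" "\<Phi> x - \<Phi> a = (x - a) * F z"
    using MVT2[OF x, of \<Phi> F] Phi_deriv by blast
  have "0 < F (min z b)" using z a_less_b cdf_strict_mono[of a "min z b"] cdf_left[of a] by auto
  also have "\<dots> \<le> F z" by (rule cdf_mono) simp
  finally show ?thesis using z x Phi_left[of a] by simp
qed

lemma Phi_growth_less: "u < b \<Longrightarrow> \<Phi> b - \<Phi> u < b - u"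
proof -
  assume u: "u < b"
  obtain z where z: "u < z" "z < b" "\<Phi> b - \<Phi> u = (b - u) * F z"
    using MVT2[OF u, of \<Phi> F] Phi_deriv by blast
  have "F z \<le> F (max a z)" by (rule cdf_mono) simp
  also have "\<dots> < 1" using z a_less_b cdf_strict_mono[of "max a z" b] cdf_right[of b] by auto
  finally show ?thesis using z u by simp
qed

lemma Phi_right: "b \<le> x \<Longrightarrow> \<Phi> x = \<Phi> b + (x - b)"
proof (cases "b = x")
  case False
  assume "b \<le> x"
  then obtain z where "b < z" "\<Phi> x - \<Phi> b = (x - b) * F z"
    using MVT2[of b x \<Phi> F] Phi_deriv False by auto
  then show ?thesis by (simp add: cdf_right)
qed simp

lemma Psi_right: "b \<le> x \<Longrightarrow> \<Psi> x = \<Psi> b + (x - b) * \<Phi> b + (x - b)\<^sup>2 / 2"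
proof (cases "b = x")
  case False
  assume "b \<le> x"
  \<comment> \<open>To the right of \<open>b\<close> the derivative of \<open>h\<close> vanishes,
    because \<Phi> is affine with slope 1 there.\<close>
  define h where "h x = \<Psi> x - (x - b) * \<Phi> b - (x - b)\<^sup>2 / 2" for x
  have h: "(h has_real_derivative \<Phi> y - \<Phi> b - (y - b)) (at y)" for y
    unfolding h_def by (auto intro!: derivative_eq_intros Psi_deriv simp: field_simps)
  have "\<exists>z. b < z \<and> z < x \<and> h x - h b = (x - b) * (\<Phi> z - \<Phi> b - (z - b))"
    by (rule MVT2) (use False \<open>b \<le> x\<close> h in auto)
  then obtain z where "b < z" "h x - h b = (x - b) * (\<Phi> z - \<Phi> b - (z - b))" by blast
  then show ?thesis using Phi_right[of z] by (simp add: h_def)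
qed simp

text \<open>With \<open>cell_right\<close>, this makes the cost of an overhang explicit: its length
  times a factor whose sign is given by \<open>Phi_pos\<close> or
  \<open>Phi_growth_less\<close>.\<close>

lemma cell_left: "u \<le> a \<Longrightarrow> cell u v = cell a v + (a - u) * \<Phi> v"
  unfolding cell_def by (simp add: Phi_left Psi_left algebra_simps)

lemma cell_right: "b \<le> v \<Longrightarrow> cell u v = cell u b + (v - b) * (b - u - (\<Phi> b - \<Phi> u))"
proof -
  assume v: "b \<le> v"
  have "2 * \<Psi> v = 2 * \<Psi> b + 2 * (v - b) * \<Phi> b + (v - b)\<^sup>2" "\<Phi> v = \<Phi> b + (v - b)"
    using Psi_right[OF v] Phi_right[OF v] by simp_all
  then show ?thesis unfolding cell_def by algebra
qed

definition clamp_ab :: "real \<Rightarrow> real" where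
  "clamp_ab x = max a (min b x)"

lemma clamp_ab_mem: "clamp_ab x \<in> {a..b}"
  using a_less_b by (auto simp: clamp_ab_def)

lemma clamp_ab_mono: "x \<le> y \<Longrightarrow> clamp_ab x \<le> clamp_ab y"
  by (auto simp: clamp_ab_def)

lemma cell_clamp_less:
  assumes "clamp_ab u < clamp_ab v" "clamp_ab u \<noteq> u \<or> clamp_ab v \<noteq> v"
  shows "cell (clamp_ab u) (clamp_ab v) < cell u v"
proof -
  have u: "u < b" and v: "a < v"
    using assms(1) a_less_b by (auto simp: clamp_ab_def max_def min_def split: if_splits)
  let ?u = "clamp_ab u" and ?v = "clamp_ab v"
  have cu: "?u < b" "?u = max a u" using u a_less_b by (auto simp: clamp_ab_def)
  have cv: "?v = min b v" using v a_less_b by (auto simp: clamp_ab_def)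
  have left: "cell u v = cell ?u v + (?u - u) * \<Phi> v"
    using cell_left[of u v] by (cases "u \<le> a") (auto simp: cu(2))
  have right: "cell ?u v = cell ?u ?v + (v - ?v) * (b - ?u - (\<Phi> b - \<Phi> ?u))"
    using cell_right[of v ?u] by (cases "b \<le> v") (auto simp: cv)
  have pos: "0 < \<Phi> v" "0 < b - ?u - (\<Phi> b - \<Phi> ?u)"
    using Phi_pos[OF v] Phi_growth_less[OF cu(1)] by auto
  have "0 \<le> ?u - u" "0 \<le> v - ?v" "0 < ?u - u \<or> 0 < v - ?v"
    using assms(2) by (auto simp: cu(2) cv)
  then have "0 < (?u - u) * \<Phi> v + (v - ?v) * (b - ?u - (\<Phi> b - \<Phi> ?u))"
    using pos by (metis add_nonneg_pos add_pos_nonneg less_imp_le mult_nonneg_nonneg mult_pos_pos)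
  with left right show ?thesis by linarith
qed

lemma cell_clamp_le:
  assumes "u \<le> v"
  shows "cell (clamp_ab u) (clamp_ab v) \<le> cell u v"
proof (cases "clamp_ab u < clamp_ab v")
  case True
  then show ?thesis using cell_clamp_less[of u v] by fastforce
next
  case False
  then have eq: "clamp_ab u = clamp_ab v" using clamp_ab_mono[OF assms] by simp
  \<comment> \<open>A cell that collapses under the projection is degenerate or lies on one side of
    \<open>(a, b)\<close>, where \<Phi> is affine and the trapezoidal rule is exact.\<close>
  consider "v \<le> a" | "b \<le> u" | "u = v"
    using eq assms a_less_b by (auto simp: clamp_ab_def max_def min_def split: if_splits)
  then have "cell u v = 0"
  proof cases
    case 1
    then show ?thesis using assms by (simp add: cell_def Phi_left Psi_left)
  next
    case 2
    have "2 * \<Psi> w = 2 * \<Psi> b + 2 * (w - b) * \<Phi> b + (w - b)\<^sup>2" if "b \<le> w" for w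
      using Psi_right[OF that] by simp
    from this[OF 2] this[of v] Phi_right[OF 2] Phi_right[of v] 2 assms
    have "2 * \<Psi> u = 2 * \<Psi> b + 2 * (u - b) * \<Phi> b + (u - b)\<^sup>2"
      "2 * \<Psi> v = 2 * \<Psi> b + 2 * (v - b) * \<Phi> b + (v - b)\<^sup>2"
      "\<Phi> u = \<Phi> b + (u - b)" "\<Phi> v = \<Phi> b + (v - b)" by auto
    then show ?thesis unfolding cell_def by algebra
  qed simp
  then show ?thesis using eq by simp
qed

end

section \<open>Minimizers of the distortion\<close>

context dual_grid
begin

text \<open>Repeated points contribute cells of value 0, so this extends the distortion continuously
  to the closed simplex, where grids with fewer points are included.\<close>

definition energy :: "(nat \<Rightarrow> real) \<Rightarrow> real" where
  "energy x = (\<Sum>j=1..<N. cell (ends x j) (ends x (Suc j)))"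

lemma continuous_on_energy: "continuous_on S energy"
proof -
  have "continuous_on UNIV \<Phi>" "continuous_on UNIV \<Psi>"
    by (intro continuous_at_imp_continuous_on ballI DERIV_isCont[OF Phi_deriv] DERIV_isCont[OF Psi_deriv])+
  moreover have "continuous_on S (\<lambda>x. ends x j)" for j
    by (cases "j = N"; cases "j = 1")
      (auto simp: with_endpoints_def intro: continuous_on_product_coordinates continuous_on_subset)
  ultimately have "continuous_on S (\<lambda>x. \<Phi> (ends x j))" "continuous_on S (\<lambda>x. \<Psi> (ends x j))"
    "continuous_on S (\<lambda>x. ends x j)" for j
    by (auto intro: continuous_on_compose2)
  then show ?thesis
    unfolding energy_def[abs_def] cell_def by (intro continuous_intros)
qed

text \<open>If a coordinate differs from its node, replacing it by the node stays in the simplex and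
  strictly lowers the energy by \<open>cell_node_less\<close>.\<close>

lemma minimizer_fixed_point:
  assumes x: "x \<in> grids" and min: "\<And>y. y \<in> grids \<Longrightarrow> energy x \<le> energy y"
  shows "sweep x = x"
proof
  fix i
  show "sweep x i = x i"
  proof (cases "i \<in> {2..N-1}")
    case False
    then show ?thesis
      using x by (auto simp: sweep_def closed_ordered_simplex_def PiE_def extensional_def)
  next
    case i: True
    let ?l = "ends x (i - 1)" and ?r = "ends x (i + 1)"
    note nb = neighbours[OF x i]
    show ?thesis
    proof (rule ccontr)
      assume "sweep x i \<noteq> x i"
      then have ne: "ends x i \<noteq> node ?l ?r" using i by (simp add: sweep_apply)
      \<comment> \<open>Coinciding neighbours would force the coordinate between them to equal the
        node.\<close>
      have lr: "?l < ?r" using ne nb by (cases "?l = ?r") auto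
      define y where "y = x(i := node ?l ?r)"
      have ends_y: "ends y j = (if j = i then node ?l ?r else ends x j)" for j
        using i by (auto simp: y_def with_endpoints_def)
      note c = node_between(1,2)[OF nb(1) lr nb(4)]
      have "y \<in> grids"
      proof (rule simplexI)
        show "y \<in> extensional {2..N-1}"
          using x i by (auto simp: y_def closed_ordered_simplex_def PiE_def extensional_def)
        show "y k \<in> {a..b}" if "k \<in> {2..N-1}" for k
          using x that c nb by (auto simp: y_def closed_ordered_simplex_def PiE_def)
        show "y j \<le> y k" if jk: "2 \<le> j" "j \<le> k" "k \<le> N - 1" for j k
        proof -
          have "x j \<le> node ?l ?r" if "j < i"
          proof -
            have "ends x j \<le> ?l" by (rule ends_mono[OF x]) (use that jk(1) i in auto)
            then show ?thesis using c(1) jk by simp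
          qed
          moreover have "node ?l ?r \<le> x k" if "i < k"
          proof -
            have "?r \<le> ends x k" by (rule ends_mono[OF x]) (use that jk in auto)
            then show ?thesis using c(2) jk by simp
          qed
          moreover have "x j \<le> x k" using ends_mono[OF x, of j k] jk by simp
          ultimately show ?thesis using jk(2) by (auto simp: y_def)
        qed
      qed
      then have "energy x \<le> energy y" by (rule min)
      moreover have "energy y < energy x"
      proof -
        have rest: "(\<Sum>j\<in>{1..<N} - {i - 1, i}. cell (ends y j) (ends y (Suc j)))
            = (\<Sum>j\<in>{1..<N} - {i - 1, i}. cell (ends x j) (ends x (Suc j)))"
          using i by (intro sum.cong) (auto simp: ends_y)
        have i': "2 \<le> i" "i < N" "Suc (i - 1) = i" "i - 1 \<noteq> i" using i by auto
        show ?thesis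
          unfolding energy_def sum_remove2[OF i'(1,2), of "\<lambda>j. cell (ends _ j) (ends _ (Suc j))"] rest
          using cell_node_less[OF nb(1) lr nb(4) _ ne] nb i' by (simp add: ends_y)
      qed
      ultimately show False by simp
    qed
  qed
qed

lemma grids_nonempty: "grids \<noteq> {}"
proof -
  have "(\<lambda>i\<in>{2..N-1}. a) \<in> grids"
    using a_less_b by (auto intro!: simplexI)
  then show ?thesis by auto
qed

lemma minimizer_exists:
  obtains x where "x \<in> grids" "\<And>y. y \<in> grids \<Longrightarrow> energy x \<le> energy y"
  using continuous_attains_inf[OF compact_closed_ordered_simplex grids_nonempty continuous_on_energy] by blast

text \<open>The form of \<open>dual_distortion\<close> once each integral is evaluated, see
  \<open>dual_distortion_eq\<close>.\<close>

definition grid_energy :: "real set \<Rightarrow> real" where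
  "grid_energy \<Gamma> = (let xs = sorted_list_of_set \<Gamma> in \<Sum>i<card \<Gamma> - 1. cell (xs ! i) (xs ! (i + 1)))"

lemma ordered_simplex_ends_less:
  assumes "x \<in> ordered_simplex a b N" "1 \<le> i" "i < j" "j \<le> N"
  shows "ends x i < ends x j"
proof -
  have x: "k \<in> {2..N-1} \<Longrightarrow> x k \<in> {a<..<b}" "strict_mono_on {2..N-1} x" for k
    using assms(1) unfolding ordered_simplex_def by (auto simp: PiE_def Pi_def)
  consider "i = 1" "j = N" | "i = 1" "j \<in> {2..N-1}" | "i \<in> {2..N-1}" "j = N" | "i \<in> {2..N-1}" "j \<in> {2..N-1}"
    using assms by force
  then show ?thesis
  proof cases
    case 4
    then show ?thesis using strict_mono_onD[OF x(2) 4] assms(3) by simp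
  qed (use x(1)[of i] x(1)[of j] a_less_b in auto)
qed

lemma ends_image: "ends x ` {1..N} = {a} \<union> x ` {2..N-1} \<union> {b}"
proof -
  have "{1..N} = insert 1 (insert N {2..N-1})" using N_ge_3 by auto
  then have "ends x ` {1..N} = ends x ` insert 1 (insert N {2..N-1})" by (rule arg_cong)
  also have "\<dots> = {a} \<union> ends x ` {2..N-1} \<union> {b}" by auto
  also have "ends x ` {2..N-1} = x ` {2..N-1}" by (intro image_cong) auto
  finally show ?thesis .
qed

lemma grid_of_ordered_simplex:
  assumes x: "x \<in> ordered_simplex a b N"
  shows "dual_quantization_grid a b N ({a} \<union> x ` {2..N-1} \<union> {b})"
    and "grid_energy ({a} \<union> x ` {2..N-1} \<union> {b}) = energy x"
proof -
  let ?\<Gamma> = "ends x ` {1..N}" and ?xs = "map (ends x) [1..<Suc N]"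
  have inj: "inj_on (ends x) {1..N}"
  proof (rule linorder_inj_onI)
    show "ends x i \<noteq> ends x j" if "i < j" "i \<in> {1..N}" "j \<in> {1..N}" for i j
      using ordered_simplex_ends_less[OF x, of i j] that by simp
  qed auto
  then have card: "card ?\<Gamma> = N" by (simp add: card_image)
  have "a \<in> ?\<Gamma>" "b \<in> ?\<Gamma>" unfolding ends_image by auto
  then have "Min ?\<Gamma> \<le> a" "b \<le> Max ?\<Gamma>" by auto
  then show "dual_quantization_grid a b N ({a} \<union> x ` {2..N-1} \<union> {b})"
    using card N_ge_3 unfolding dual_quantization_grid_def ends_image[symmetric] by auto
  have "sorted_wrt (<) ?xs"
    unfolding sorted_wrt_iff_nth_less using ordered_simplex_ends_less[OF x] by (auto simp del: upt_Suc)
  moreover have "set ?xs = ?\<Gamma>" by (simp add: atLeastLessThanSuc_atLeastAtMost del: upt_Suc)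
  ultimately have "sorted_list_of_set ?\<Gamma> = ?xs"
    using sorted_list_of_set_unique[of ?\<Gamma> ?xs] card by (simp del: upt_Suc)
  then have "grid_energy ?\<Gamma> = (\<Sum>i<N-1. cell (?xs ! i) (?xs ! (i + 1)))"
    by (simp only: grid_energy_def card Let_def)
  also have "\<dots> = (\<Sum>i<N-1. cell (ends x (Suc i)) (ends x (Suc (Suc i))))"
    by (intro sum.cong) (auto simp del: upt_Suc)
  also have "\<dots> = energy x"
    unfolding energy_def by (rule sum.reindex_bij_witness[of _ "\<lambda>j. j - 1" Suc]) auto
  finally show "grid_energy ({a} \<union> x ` {2..N-1} \<union> {b}) = energy x"
    unfolding ends_image .
qed

text \<open>
  Moving the points of a grid into \<open>[a, b]\<close> and repeating the last one yields a point of the closed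
  simplex; this does not increase the distortion.
\<close>

lemma simplex_of_grid:
  assumes "dual_quantization_grid a b N \<Gamma>"
  obtains x where "x \<in> grids" "energy x \<le> grid_energy \<Gamma>"
    "x \<in> ordered_simplex a b N \<Longrightarrow> energy x = grid_energy \<Gamma> \<Longrightarrow> \<Gamma> = {a} \<union> x ` {2..N-1} \<union> {b}"
proof -
  define xs where "xs = sorted_list_of_set \<Gamma>"
  define M where "M = card \<Gamma>"
  have \<Gamma>: "finite \<Gamma>" "\<Gamma> \<noteq> {}" "M \<le> N" "Min \<Gamma> \<le> a" "b \<le> Max \<Gamma>"
    using assms by (auto simp: dual_quantization_grid_def M_def)
  have xs: "sorted xs" "distinct xs" "set xs = \<Gamma>" "length xs = M"
    using \<Gamma> by (auto simp: xs_def M_def)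
  have M: "0 < M" using \<Gamma> by (auto simp: M_def card_gt_0_iff)
  have sorted: "xs ! i \<le> xs ! j" if "i \<le> j" "j < M" for i j
    using sorted_nth_mono[OF xs(1)] that xs(4) by simp
  have first: "xs ! 0 \<le> a"
  proof -
    obtain i where "i < M" "xs ! i = Min \<Gamma>"
      using Min_in[OF \<Gamma>(1,2)] xs(3,4) by (metis in_set_conv_nth)
    then show ?thesis using sorted[of 0 i] \<Gamma>(4) by simp
  qed
  have last: "b \<le> xs ! (M - 1)"
  proof -
    obtain i where "i < M" "xs ! i = Max \<Gamma>"
      using Max_in[OF \<Gamma>(1,2)] xs(3,4) by (metis in_set_conv_nth)
    then have "xs ! i \<le> xs ! (M - 1)" by (intro sorted) auto
    then show ?thesis using \<open>xs ! i = Max \<Gamma>\<close> \<Gamma>(5) by simp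
  qed
  \<comment> \<open>Simplex index \<open>j\<close> corresponds to list position
    \<open>j - 1\<close>; the minimum repeats the last point when the grid has fewer than
    \<open>N\<close> points.\<close>
  define y where "y j = clamp_ab (xs ! min (j - 1) (M - 1))" for j
  have y1: "y 1 = a" using first a_less_b by (simp add: y_def clamp_ab_def)
  have yM: "y j = b" if "M \<le> j" for j
  proof -
    have "min (j - 1) (M - 1) = M - 1" using that by simp
    then show ?thesis using last a_less_b by (simp add: y_def clamp_ab_def)
  qed
  have y_mono: "y i \<le> y j" if "i \<le> j" for i j
    using that M unfolding y_def by (intro clamp_ab_mono sorted) auto
  define x where "x = restrict y {2..N-1}"
  have ends_x: "ends x j = y j" if j: "j \<in> {1..N}" for j
  proof -
    consider "j = 1" | "j = N" | "j \<in> {2..N-1}" using j by force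
    then show ?thesis
    proof cases
      case 2
      then show ?thesis using yM[of N] \<Gamma>(3) by simp
    qed (use y1 in \<open>auto simp: x_def\<close>)
  qed
  have x: "x \<in> grids"
    by (rule simplexI) (use y_mono clamp_ab_mem in \<open>auto simp: x_def, auto simp: y_def\<close>)
  have "energy x = (\<Sum>j=1..<N. cell (y j) (y (Suc j)))"
    unfolding energy_def by (intro sum.cong) (auto simp: ends_x)
  \<comment> \<open>From index \<open>M\<close> on all points equal \<open>b\<close>, so these cells
    are 0.\<close>
  also have "\<dots> = (\<Sum>j=1..<M. cell (y j) (y (Suc j)))"
    by (rule sum.mono_neutral_right) (use \<Gamma>(3) yM in auto)
  also have "\<dots> = (\<Sum>i<M-1. cell (clamp_ab (xs ! i)) (clamp_ab (xs ! (i + 1))))"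
    by (rule sum.reindex_bij_witness[of _ Suc "\<lambda>j. j - 1"]) (auto simp: y_def min_def)
  finally have energy: "energy x = (\<Sum>i<M-1. cell (clamp_ab (xs ! i)) (clamp_ab (xs ! (i + 1))))" .
  have genergy: "grid_energy \<Gamma> = (\<Sum>i<M-1. cell (xs ! i) (xs ! (i + 1)))"
    by (simp only: grid_energy_def M_def xs_def Let_def)
  have le: "cell (clamp_ab (xs ! i)) (clamp_ab (xs ! (i + 1))) \<le> cell (xs ! i) (xs ! (i + 1))"
    if "i \<in> {..<M-1}" for i
    using that sorted[of i "i + 1"] by (intro cell_clamp_le) auto
  show thesis
  proof (rule that[OF x])
    show "energy x \<le> grid_energy \<Gamma>"
      unfolding energy genergy by (intro sum_mono le)
    assume ord: "x \<in> ordered_simplex a b N" and eq: "energy x = grid_energy \<Gamma>"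
    have less: "y i < y j" if "1 \<le> i" "i < j" "j \<le> N" for i j
      using ordered_simplex_ends_less[OF ord, of i j] that by (simp add: ends_x)
    have "M = N"
    proof (rule ccontr)
      assume "M \<noteq> N"
      then have "y M < y N" using M \<Gamma>(3) by (intro less) auto
      then show False using yM[of M] yM[of N] \<Gamma>(3) by simp
    qed
    \<comment> \<open>Equality of the sums forces equality in every cell, and a cell with an
      overhang would be strictly improved by the projection.\<close>
    have fixed: "clamp_ab (xs ! i) = xs ! i \<and> clamp_ab (xs ! (i + 1)) = xs ! (i + 1)" if i: "i < N - 1" for i
    proof -
      have "cell (clamp_ab (xs ! i)) (clamp_ab (xs ! (i + 1))) = cell (xs ! i) (xs ! (i + 1))"
        by (rule sum_mono_inv[OF _ le]) (use eq i \<open>M = N\<close> in \<open>auto simp: energy genergy\<close>)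
      moreover have "clamp_ab (xs ! i) < clamp_ab (xs ! (i + 1))"
        using less[of "i + 1" "i + 2"] i \<open>M = N\<close> by (simp add: y_def)
      ultimately show ?thesis using cell_clamp_less[of "xs ! i" "xs ! (i + 1)"] by auto
    qed
    have y_xs: "y (Suc i) = xs ! i" if "i < N" for i
    proof (cases "i < N - 1")
      case True
      then show ?thesis using fixed[of i] \<open>M = N\<close> by (simp add: y_def)
    next
      case False
      \<comment> \<open>The last point is reached as the right end of the last cell.\<close>
      then have "i = N - 2 + 1" using that N_ge_3 by simp
      then show ?thesis using fixed[of "N - 2"] N_ge_3 \<open>M = N\<close> by (simp add: y_def)
    qed
    have "\<Gamma> = (\<lambda>i. xs ! i) ` {..<N}"
      using xs(3,4) \<open>M = N\<close> by (auto simp: set_conv_nth)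
    also have "\<dots> = (\<lambda>i. ends x (Suc i)) ` {..<N}"
      by (intro image_cong) (auto simp: ends_x y_xs)
    also have "\<dots> = ends x ` {1..N}"
      by (simp add: image_image[of "ends x" Suc, symmetric] image_Suc_lessThan)
    finally show "\<Gamma> = {a} \<union> x ` {2..N-1} \<union> {b}" unfolding ends_image .
  qed
qed

text \<open>Every minimizer of the energy is a fixed point, and there is only one fixed point; hence
  \<open>x\<close> is the unique minimizer. \<open>simplex_of_grid\<close> carries this over to
  arbitrary grids, its equality case giving uniqueness.\<close>

lemma fixed_point_optimal:
  assumes x: "x \<in> grids" "sweep x = x"
  shows "is_arg_min grid_energy (dual_quantization_grid a b N) \<Gamma> \<longleftrightarrow> \<Gamma> = {a} \<union> x ` {2..N-1} \<union> {b}"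
proof -
  let ?\<Gamma> = "{a} \<union> x ` {2..N-1} \<union> {b}"
  have unique: "y = x" if "y \<in> grids" "\<And>z. z \<in> grids \<Longrightarrow> energy y \<le> energy z" for y
    using fixed_point_unique[OF x that(1)] minimizer_fixed_point[OF that] by simp
  then have min: "energy x \<le> energy y" if "y \<in> grids" for y
    using minimizer_exists that by metis
  have ord: "x \<in> ordered_simplex a b N" by (rule fixed_point_ordered[OF x])
  note grid = grid_of_ordered_simplex[OF ord]
  have le: "grid_energy ?\<Gamma> \<le> grid_energy \<Delta>" if "dual_quantization_grid a b N \<Delta>" for \<Delta>
    using simplex_of_grid[OF that] min grid(2) by (metis order_trans)
  have "\<Delta> = ?\<Gamma>" if \<Delta>: "dual_quantization_grid a b N \<Delta>" "grid_energy \<Delta> \<le> grid_energy ?\<Gamma>" for \<Delta>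
  proof -
    obtain y where y: "y \<in> grids" "energy y \<le> grid_energy \<Delta>"
      "y \<in> ordered_simplex a b N \<Longrightarrow> energy y = grid_energy \<Delta> \<Longrightarrow> \<Delta> = {a} \<union> y ` {2..N-1} \<union> {b}"
      by (rule simplex_of_grid[OF \<Delta>(1)]) blast
    have "energy y \<le> energy x" using y(2) \<Delta>(2) grid(2) by linarith
    then have "y = x" using min by (intro unique y(1)) (blast intro: order_trans)
    then show ?thesis using y(2,3) ord \<Delta>(2) grid(2) by simp
  qed
  then show ?thesis
    using grid(1) le unfolding is_arg_min_linorder by blast
qed

end

section \<open>A cell as an integral against the density\<close>

context log_concave_cdf
begin

lemma has_integral_cell:
  assumes zero: "\<And>x. x \<notin> {a<..<b} \<Longrightarrow> f x = 0" and "u < v"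
  shows "((\<lambda>\<xi>. (\<xi> - u) * (v - \<xi>) * f \<xi>) has_integral cell u v) {u..v}"
proof -
  \<comment> \<open>The antiderivative obtained by integrating by parts twice. \<open>F\<close> may
    fail to be differentiable at \<open>a\<close> and \<open>b\<close>, where \<open>f\<close> can
    jump, so these two points are exceptional; continuity of \<open>H\<close> suffices
    there.\<close>
  define H where "H \<xi> = (\<xi> - u) * (v - \<xi>) * F \<xi> - (u + v - 2 * \<xi>) * \<Phi> \<xi> - 2 * \<Psi> \<xi>" for \<xi>
  have F_deriv: "(F has_real_derivative f \<xi>) (at \<xi>)" if ab: "\<xi> \<noteq> a" "\<xi> \<noteq> b" for \<xi>
  proof -
    consider "\<xi> < a" | "\<xi> \<in> {a<..<b}" | "b < \<xi>" using ab by force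
    then show ?thesis
    proof cases
      case 1
      have "\<forall>\<^sub>F x in nhds \<xi>. F x = 0"
        using eventually_nhds_in_open[of "{..<a}" \<xi>] 1 by (auto elim!: eventually_mono simp: cdf_left)
      from DERIV_cong_ev[OF refl this refl] show ?thesis using zero[of \<xi>] 1 by simp
    next
      case 3
      have "\<forall>\<^sub>F x in nhds \<xi>. F x = 1"
        using eventually_nhds_in_open[of "{b<..}" \<xi>] 3 by (auto elim!: eventually_mono simp: cdf_right)
      from DERIV_cong_ev[OF refl this refl] show ?thesis using zero[of \<xi>] 3 by simp
    qed (rule cdf_deriv)
  qed
  have "(H has_real_derivative (\<xi> - u) * (v - \<xi>) * f \<xi>) (at \<xi>)" if "\<xi> \<noteq> a" "\<xi> \<noteq> b" for \<xi>
    unfolding H_def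
    by (auto intro!: derivative_eq_intros F_deriv that Phi_deriv Psi_deriv simp: algebra_simps)
  then have "(H has_vector_derivative (\<xi> - u) * (v - \<xi>) * f \<xi>) (at \<xi>)" if "\<xi> \<in> {u<..<v} - {a, b}" for \<xi>
    using that by (simp add: has_real_derivative_iff_has_vector_derivative)
  moreover have "continuous_on {u..v} H"
    unfolding H_def
    by (intro continuous_at_imp_continuous_on ballI continuous_intros cdf_cont
        DERIV_isCont[OF Phi_deriv] DERIV_isCont[OF Psi_deriv])
  ultimately have "((\<lambda>\<xi>. (\<xi> - u) * (v - \<xi>) * f \<xi>) has_integral (H v - H u)) {u..v}"
    using \<open>u < v\<close> by (intro fundamental_theorem_of_calculus_interior_strong[of "{a, b}"]) auto
  also have "H v - H u = cell u v"
    by (simp add: H_def cell_def algebra_simps)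
  finally show ?thesis .
qed

end

section \<open>Distributions with a log-concave density\<close>

locale log_concave_distribution =
  fixes a b :: real and f :: "real \<Rightarrow> real" and \<mu> :: "real measure"
  assumes interval: "a < b"
    and prob: "prob_space \<mu>"
    and borel_density: "f \<in> borel_measurable borel"
    and distribution: "\<mu> = density lborel (\<lambda>x. ennreal (f x))"
    and log_concave_density: "log_concave_on {a<..<b} f"
    and density_zero: "\<And>x. x \<notin> {a<..<b} \<Longrightarrow> f x = 0"
begin

lemma density_nonneg: "0 \<le> f x"
  using log_concave_density density_zero[of x] by (cases "x \<in> {a<..<b}") (auto simp: log_concave_on_def less_imp_le)

lemma density_outside: "x \<le> a \<or> b \<le> x \<Longrightarrow> f x = 0"
  by (rule density_zero) auto

lemma real_distribution: "real_distribution \<mu>"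
  using prob by (simp add: real_distribution_def real_distribution_axioms_def distribution)

lemma integrable_density: "integrable lborel f"
proof (rule integrableI_nonneg)
  have "emeasure \<mu> UNIV = 1"
    using prob_space.emeasure_space_1[OF prob] by (simp add: distribution)
  then have "(\<integral>\<^sup>+ x. ennreal (f x) \<partial>lborel) = 1"
    using borel_density by (simp add: distribution emeasure_density)
  then show "(\<integral>\<^sup>+ x. ennreal (f x) \<partial>lborel) < \<infinity>" by simp
qed (use borel_density density_nonneg in auto)

lemma set_integral_distribution:
  assumes "A \<in> sets borel" "h \<in> borel_measurable borel"
  shows "(LINT x:A|\<mu>. h x) = (LINT x:A|lborel. h x * f x :: real)"
  using assms borel_density density_nonneg unfolding set_lebesgue_integral_def distribution
  by (subst integral_density) (auto simp: mult_ac)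

lemma measure_distribution:
  assumes "A \<in> sets borel"
  shows "measure \<mu> A = (LINT x:A|lborel. f x)"
  using set_integral_distribution[OF assms, of "\<lambda>_. 1"] assms
  by (simp add: set_lebesgue_integral_def distribution)

lemma integrable_on_density: "A \<in> sets borel \<Longrightarrow> set_integrable lborel A f"
  unfolding set_integrable_def using integrable_mult_indicator[OF _ integrable_density] by simp

lemma measure_eq_integral: "A \<in> sets borel \<Longrightarrow> measure \<mu> A = integral A f"
  using measure_distribution set_borel_integral_eq_integral(2)[OF integrable_on_density] by simp

lemma cdf_isCont: "isCont (cdf \<mu>) x"
proof -
  interpret real_distribution \<mu> by (rule real_distribution)
  show ?thesis unfolding isCont_cdf using measure_eq_integral[of "{x}"] by simp
qed

lemma cdf_diff: "x < y \<Longrightarrow> cdf \<mu> y - cdf \<mu> x = integral {x..y} f"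
proof -
  assume "x < y"
  interpret real_distribution \<mu> by (rule real_distribution)
  have "{x..y} = {x} \<union> {x<..y}" using \<open>x < y\<close> by auto
  then have "measure \<mu> {x..y} = measure \<mu> ({x} \<union> {x<..y})" by simp
  also have "\<dots> = measure \<mu> {x} + measure \<mu> {x<..y}"
    by (rule finite_measure_Union) auto
  also have "measure \<mu> {x} = 0" using measure_eq_integral[of "{x}"] by simp
  finally show ?thesis using cdf_diff_eq[OF \<open>x < y\<close>] measure_eq_integral[of "{x..y}"] by simp
qed

lemma cdf_has_derivative:
  assumes x: "x \<in> {a<..<b}"
  shows "(cdf \<mu> has_real_derivative f x) (at x)"
proof -
  \<comment> \<open>A compact neighbourhood of \<open>x\<close> inside \<open>(a, b)\<close>, since
    \<open>f\<close> may be discontinuous at the end points.\<close>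
  define c d where "c = (a + x) / 2" and "d = (x + b) / 2"
  have cd: "a < c" "c < x" "x < d" "d < b" using x by (auto simp: c_def d_def)
  have "continuous_on {c..d} f"
    using cd by (intro continuous_at_imp_continuous_on ballI
        log_concave_on_isCont[OF _ log_concave_density]) auto
  then have "((\<lambda>y. integral {c..y} f) has_real_derivative f x) (at x within {c..d})"
    by (rule integral_has_real_derivative) (use cd in auto)
  then have "((\<lambda>y. integral {c..y} f) has_real_derivative f x) (at x)"
    using cd by (simp add: at_within_interior[of x "{c..d}"])
  then have d: "((\<lambda>y. cdf \<mu> c + integral {c..y} f) has_real_derivative f x) (at x)"
    by (auto intro!: derivative_eq_intros)
  have "\<forall>\<^sub>F y in nhds x. cdf \<mu> y = cdf \<mu> c + integral {c..y} f"
    using eventually_nhds_in_open[of "{c<..}" x] cd(2)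
    by (auto elim!: eventually_mono simp: cdf_diff[symmetric])
  from DERIV_cong_ev[OF refl this refl] d show ?thesis by simp
qed

lemma cdf_eq_0: "x \<le> a \<Longrightarrow> cdf \<mu> x = 0"
proof -
  assume "x \<le> a"
  then have "integral {..x} f = integral {..x} (\<lambda>_. 0)"
    by (intro integral_cong density_outside) auto
  then show ?thesis by (simp add: cdf_def measure_eq_integral)
qed

lemma cdf_eq_1: "b \<le> x \<Longrightarrow> cdf \<mu> x = 1"
proof -
  assume "b \<le> x"
  interpret real_distribution \<mu> by (rule real_distribution)
  have "measure \<mu> {x<..} = integral {x<..} f" by (simp add: measure_eq_integral)
  also have "\<dots> = integral {x<..} (\<lambda>_. 0)"
    by (intro integral_cong density_outside) (use \<open>b \<le> x\<close> in auto)
  finally have "measure \<mu> {x<..} = 0" by simp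
  moreover have "measure \<mu> (space \<mu> - {x<..}) = 1 - measure \<mu> {x<..}"
    by (rule prob_compl) simp
  moreover have "space \<mu> - {x<..} = {..x}" by auto
  ultimately show ?thesis by (simp add: cdf_def)
qed

lemma cdf_antiderivatives:
  obtains \<Phi> \<Psi> where "log_concave_cdf a b f (cdf \<mu>) \<Phi> \<Psi>"
proof -
  obtain \<Phi> where \<Phi>: "\<And>x. (\<Phi> has_real_derivative cdf \<mu> x) (at x)" "\<And>x. x \<le> a \<Longrightarrow> \<Phi> x = 0"
    by (rule continuous_antiderivative_exists[of "cdf \<mu>" a]) (use cdf_isCont cdf_eq_0 in auto)
  obtain \<Psi> where \<Psi>: "\<And>x. (\<Psi> has_real_derivative \<Phi> x) (at x)" "\<And>x. x \<le> a \<Longrightarrow> \<Psi> x = 0"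
    by (rule continuous_antiderivative_exists[of \<Phi> a]) (use DERIV_isCont[OF \<Phi>(1)] \<Phi>(2) in auto)
  show thesis
    by (rule that[of \<Phi> \<Psi>], unfold_locales)
      (use interval log_concave_density cdf_eq_0 cdf_eq_1 cdf_isCont cdf_has_derivative \<Phi> \<Psi> in auto)
qed

end

section \<open>Transfer to the measure\<close>

locale dual_quantization = log_concave_distribution a b f \<mu> + dual_grid a b f "cdf \<mu>" \<Phi> \<Psi> N
  for a b :: real and f :: "real \<Rightarrow> real" and \<mu> :: "real measure" and \<Phi> \<Psi> :: "real \<Rightarrow> real" and N :: nat
begin

lemma grid_map_eq_sweep: "grid_map \<mu> a b N x = sweep x" if x: "x \<in> grids"
proof
  fix i
  show "grid_map \<mu> a b N x i = sweep x i"
  proof (cases "i \<in> {2..N-1}")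
    case i: True
    let ?l = "ends x (i - 1)" and ?r = "ends x (i + 1)"
    note nb = neighbours[OF x i]
    show ?thesis
    proof (cases "?l < ?r")
      case True
      have "(LINT \<xi>:{?l..?r}|lborel. cdf \<mu> \<xi>) = \<Phi> ?r - \<Phi> ?l"
        unfolding set_lebesgue_integral_def
      proof (rule integral_FTC_atLeastAtMost)
        show "(\<Phi> has_vector_derivative cdf \<mu> y) (at y within {?l..?r})" for y
          using has_field_derivative_at_within[OF Phi_deriv]
          by (simp add: has_real_derivative_iff_has_vector_derivative)
        show "continuous_on {?l..?r} (cdf \<mu>)"
          by (intro continuous_at_imp_continuous_on ballI cdf_isCont)
      qed (use True in simp)
      then show ?thesis
        using True i by (simp add: grid_map_def sweep_apply node_def Let_def)
    next
      case False
      \<comment> \<open>On the closed simplex coinciding neighbours enclose \<open>x i\<close>, so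
        the two default values agree.\<close>
      then have "x i = ?l" "?l = ?r" using nb i by auto
      then show ?thesis
        using False i by (simp add: grid_map_def sweep_apply node_def Let_def)
    qed
  next
    case False
    then show ?thesis by (simp only: grid_map_def sweep_def restrict_apply if_False)
  qed
qed

lemma funpow_grid_map: "x \<in> grids \<Longrightarrow> (grid_map \<mu> a b N ^^ l) x = (sweep ^^ l) x"
  by (induction l) (simp_all add: grid_map_eq_sweep funpow_sweep_closed)

lemma distortion_cell:
  assumes "u < v"
  shows "(LINT \<xi>:{u..<v}|\<mu>. (\<xi> - u)\<^sup>2 * ((v - \<xi>) / (v - u)) + (v - \<xi>)\<^sup>2 * ((\<xi> - u) / (v - u))) = cell u v"
proof -
  \<comment> \<open>The common factor \<open>(\<xi> - u) * (v - \<xi>)\<close> is multiplied by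
    \<open>(\<xi> - u) + (v - \<xi>)\<close>, which cancels the denominator.\<close>
  have "(\<xi> - u)\<^sup>2 * ((v - \<xi>) / (v - u)) + (v - \<xi>)\<^sup>2 * ((\<xi> - u) / (v - u)) = (\<xi> - u) * (v - \<xi>)" for \<xi>
  proof -
    have "(\<xi> - u)\<^sup>2 * ((v - \<xi>) / (v - u)) + (v - \<xi>)\<^sup>2 * ((\<xi> - u) / (v - u))
      = ((\<xi> - u) * (v - \<xi>) * (v - u)) / (v - u)"
      unfolding times_divide_eq_right add_divide_distrib[symmetric]
      by (rule arg_cong[of _ _ "\<lambda>t. t / (v - u)"]) algebra
    then show ?thesis using assms by simp
  qed
  then have "(LINT \<xi>:{u..<v}|\<mu>. (\<xi> - u)\<^sup>2 * ((v - \<xi>) / (v - u)) + (v - \<xi>)\<^sup>2 * ((\<xi> - u) / (v - u)))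
      = (LINT \<xi>:{u..<v}|lborel. (\<xi> - u) * (v - \<xi>) * f \<xi>)"
    by (simp add: set_integral_distribution)
  also have "\<dots> = integral {u..<v} (\<lambda>\<xi>. (\<xi> - u) * (v - \<xi>) * f \<xi>)"
  proof (rule set_borel_integral_eq_integral(2))
    show "set_integrable lborel {u..<v} (\<lambda>\<xi>. (\<xi> - u) * (v - \<xi>) * f \<xi>)"
      unfolding set_integrable_def
    proof (rule Bochner_Integration.integrable_bound)
      show "integrable lborel (\<lambda>\<xi>. (v - u) * (v - u) * f \<xi>)"
        using integrable_density by simp
      show "(\<lambda>\<xi>. indicator {u..<v} \<xi> *\<^sub>R ((\<xi> - u) * (v - \<xi>) * f \<xi>)) \<in> borel_measurable lborel"
        using borel_density by measurable
      have "\<bar>(\<xi> - u) * (v - \<xi>) * f \<xi>\<bar> \<le> \<bar>(v - u) * (v - u) * f \<xi>\<bar>" if "\<xi> \<in> {u..<v}" for \<xi>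
        using that density_nonneg[of \<xi>] unfolding abs_mult by (intro mult_mono) auto
      then show "AE \<xi> in lborel. norm (indicator {u..<v} \<xi> *\<^sub>R ((\<xi> - u) * (v - \<xi>) * f \<xi>))
          \<le> norm ((v - u) * (v - u) * f \<xi>)"
        by (intro AE_I2) (auto simp: indicator_def)
    qed
  qed
  \<comment> \<open>The half-open and the closed interval differ in \<open>v\<close>, where the
    integrand is 0.\<close>
  also have "((\<lambda>\<xi>. (\<xi> - u) * (v - \<xi>) * f \<xi>) has_integral cell u v) {u..<v}"
  proof (subst has_integral_spike_set_eq[of _ "{u..v}"])
    have "{x \<in> {u..<v} - {u..v}. (x - u) * (v - x) * f x \<noteq> 0} = {}"
      "{x \<in> {u..v} - {u..<v}. (x - u) * (v - x) * f x \<noteq> 0} = {}" by auto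
    then show "negligible {x \<in> {u..<v} - {u..v}. (x - u) * (v - x) * f x \<noteq> 0}"
      "negligible {x \<in> {u..v} - {u..<v}. (x - u) * (v - x) * f x \<noteq> 0}"
      by (simp_all only: negligible_empty)
  qed (rule has_integral_cell[OF density_zero assms])
  then have "integral {u..<v} (\<lambda>\<xi>. (\<xi> - u) * (v - \<xi>) * f \<xi>) = cell u v"
    by (rule integral_unique)
  finally show ?thesis .
qed

lemma dual_distortion_eq: "dual_distortion \<mu> \<Gamma> = grid_energy \<Gamma>"
  unfolding dual_distortion_def grid_energy_def Let_def
proof (intro sum.cong refl distortion_cell)
  fix i assume i: "i \<in> {..<card \<Gamma> - 1}"
  \<comment> \<open>Infinite sets have cardinality 0 and thus no valid index.\<close>
  then have "finite \<Gamma>" using card.infinite by fastforce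
  have "sorted_wrt (<) (sorted_list_of_set \<Gamma>)"
    by (simp add: \<open>finite \<Gamma>\<close>)
  then show "sorted_list_of_set \<Gamma> ! i < sorted_list_of_set \<Gamma> ! (i + 1)"
    by (rule sorted_wrt_nth_less) (use i \<open>finite \<Gamma>\<close> in auto)
qed

lemma quadratic_optimal_grid_iff:
  assumes "x \<in> grids" "sweep x = x"
  shows "quadratic_optimal_grid \<mu> a b N \<Gamma> \<longleftrightarrow> \<Gamma> = {a} \<union> x ` {2..N-1} \<union> {b}"
proof -
  have "dual_distortion \<mu> = grid_energy" by (rule ext) (rule dual_distortion_eq)
  then show ?thesis
    using fixed_point_optimal[OF assms] by (simp only: quadratic_optimal_grid_def)
qed

end

text \<open>Both divisors equal \<open>\<lceil>N / 2\<rceil> - 1\<close> in truncated arithmetic;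
  when they are 0, both quotients are 0 by convention.\<close>

lemma floor_block_index:
  "nat \<lfloor>real l / real (nat \<lceil>real N / 2\<rceil> - 1)\<rfloor> = l div ((N - 1) div 2)"
proof -
  have "nat \<lceil>real N / 2\<rceil> = (N + 1) div 2"
  proof (cases "even N")
    case True
    then show ?thesis by (auto elim!: evenE)
  next
    case False
    then obtain k where k: "N = 2 * k + 1" by (auto elim: oddE)
    have "\<lceil>real N / 2\<rceil> = int k + 1" by (rule ceiling_unique) (auto simp: k)
    then show ?thesis by (simp add: k nat_add_distrib)
  qed
  moreover have "(N + 1) div 2 - 1 = (N - 1) div 2" by presburger
  ultimately have "nat \<lceil>real N / 2\<rceil> - 1 = (N - 1) div 2" by (simp only:)
  then show ?thesis by (simp only: floor_divide_of_nat_eq nat_int)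
qed

theorem theorem3p1:
  fixes a b :: real and N :: nat and \<mu> :: "real measure" and f :: "real \<Rightarrow> real"
  assumes "a < b"
    and "3 \<le> N"
    and "prob_space \<mu>"
    and "f \<in> borel_measurable borel"
    and "\<mu> = density lborel (\<lambda>x. ennreal (f x))"
    and "\<And>x. x \<in> {a<..<b} \<Longrightarrow> 0 < f x"
    and "log_concave_on {a<..<b} f"
    and "\<And>x. x \<notin> {a<..<b} \<Longrightarrow> f x = 0"
  shows "grid_map \<mu> a b N \<in> closed_ordered_simplex a b N \<rightarrow> closed_ordered_simplex a b N \<and>
    (\<exists>xstar.
      xstar \<in> closed_ordered_simplex a b N \<and> grid_map \<mu> a b N xstar = xstar \<and>
      (\<forall>y\<in>closed_ordered_simplex a b N. grid_map \<mu> a b N y = y \<longrightarrow> y = xstar) \<and>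
      xstar \<in> ordered_simplex a b N \<and>
      quadratic_optimal_grid \<mu> a b N ({a} \<union> xstar ` {2..N-1} \<union> {b}) \<and>
      (\<forall>\<Gamma>. quadratic_optimal_grid \<mu> a b N \<Gamma> \<longrightarrow> \<Gamma> = {a} \<union> xstar ` {2..N-1} \<union> {b}) \<and>
      (\<exists>\<rho>. 0 \<le> \<rho> \<and> \<rho> < 1 \<and>
        (\<forall>x0\<in>closed_ordered_simplex a b N.
          (\<forall>l. max_norm N (\<lambda>i. (grid_map \<mu> a b N ^^ l) x0 i - xstar i)
              \<le> max_norm N (\<lambda>i. x0 i - xstar i)
                 * \<rho> ^ nat \<lfloor>real l / real (nat \<lceil>real N / 2\<rceil> - 1)\<rfloor>) \<and>
          (strictly_log_concave_on {a<..<b} f \<longrightarrow>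
            (\<forall>l. max_norm N (\<lambda>i. (grid_map \<mu> a b N ^^ l) x0 i - xstar i)
              \<le> max_norm N (\<lambda>i. x0 i - xstar i) * \<rho> ^ l)))))"
proof -
  interpret log_concave_distribution a b f \<mu>
    by (rule log_concave_distribution.intro) (fact assms)+
  obtain \<Phi> \<Psi> where "log_concave_cdf a b f (cdf \<mu>) \<Phi> \<Psi>"
    by (rule cdf_antiderivatives)
  then interpret dual_quantization a b f \<mu> \<Phi> \<Psi> N
    using \<open>3 \<le> N\<close> log_concave_distribution_axioms
    by (simp add: dual_quantization_def dual_grid_def dual_grid_axioms_def)
  \<comment> \<open>Existence of a fixed point comes from minimizing the energy.\<close>
  obtain x where "x \<in> grids" "\<And>y. y \<in> grids \<Longrightarrow> energy x \<le> energy y"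
    using minimizer_exists by blast
  then have x: "x \<in> grids" "sweep x = x" using minimizer_fixed_point by auto
  obtain \<rho> where \<rho>: "0 \<le> \<rho>" "\<rho> < 1"
    and blockwise: "\<And>y l. y \<in> grids \<Longrightarrow> max_norm N (\<lambda>i. (sweep ^^ l) y i - x i)
      \<le> max_norm N (\<lambda>i. y i - x i) * \<rho> ^ (l div ((N - 1) div 2))"
    using sweep_blockwise_convergence[OF x] by blast
  obtain \<sigma> where \<sigma>: "0 \<le> \<sigma>" "\<sigma> < 1"
    and linear: "\<And>y l. strictly_log_concave_on {a<..<b} f \<Longrightarrow> y \<in> grids \<Longrightarrow>
      max_norm N (\<lambda>i. (sweep ^^ l) y i - x i) \<le> max_norm N (\<lambda>i. y i - x i) * \<sigma> ^ l"
  proof (cases "strictly_log_concave_on {a<..<b} f")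
    case True
    show ?thesis
      by (rule sweep_linear_convergence[OF x True]) (rule that)
  next
    case False
    then show ?thesis using that[of 0] by simp
  qed
  have nonneg: "0 \<le> max_norm N z" for z
    using order_trans[OF abs_ge_zero abs_le_max_norm[of 2 N z]] N_ge_3 by simp
  \<comment> \<open>The two rates are found separately; their maximum is a single \<rho> for both
    estimates.\<close>
  have weaken: "max_norm N z * s ^ k \<le> max_norm N z * max \<rho> \<sigma> ^ k" if "0 \<le> s" "s \<le> max \<rho> \<sigma>" for z s k
    using that by (intro mult_left_mono power_mono nonneg)
  have rate: "\<forall>x0\<in>grids.
          (\<forall>l. max_norm N (\<lambda>i. (grid_map \<mu> a b N ^^ l) x0 i - x i)
              \<le> max_norm N (\<lambda>i. x0 i - x i)
                 * max \<rho> \<sigma> ^ nat \<lfloor>real l / real (nat \<lceil>real N / 2\<rceil> - 1)\<rfloor>) \<and>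
          (strictly_log_concave_on {a<..<b} f \<longrightarrow>
            (\<forall>l. max_norm N (\<lambda>i. (grid_map \<mu> a b N ^^ l) x0 i - x i)
              \<le> max_norm N (\<lambda>i. x0 i - x i) * max \<rho> \<sigma> ^ l))"
  proof (intro ballI conjI allI impI)
    fix y l assume y: "y \<in> grids"
    show "max_norm N (\<lambda>i. (grid_map \<mu> a b N ^^ l) y i - x i)
        \<le> max_norm N (\<lambda>i. y i - x i) * max \<rho> \<sigma> ^ nat \<lfloor>real l / real (nat \<lceil>real N / 2\<rceil> - 1)\<rfloor>"
      unfolding floor_block_index funpow_grid_map[OF y]
      by (rule order_trans[OF blockwise[OF y] weaken]) (use \<rho> in auto)
    assume s: "strictly_log_concave_on {a<..<b} f"
    show "max_norm N (\<lambda>i. (grid_map \<mu> a b N ^^ l) y i - x i) \<le> max_norm N (\<lambda>i. y i - x i) * max \<rho> \<sigma> ^ l"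
      unfolding funpow_grid_map[OF y]
      by (rule order_trans[OF linear[OF s y] weaken]) (use \<sigma> in auto)
  qed
  have maps: "grid_map \<mu> a b N \<in> grids \<rightarrow> grids"
    using sweep_closed by (auto simp: grid_map_eq_sweep)
  have fixed: "grid_map \<mu> a b N x = x"
    using x by (simp add: grid_map_eq_sweep)
  have unique: "\<forall>y\<in>grids. grid_map \<mu> a b N y = y \<longrightarrow> y = x"
    using fixed_point_unique[OF x] by (auto simp: grid_map_eq_sweep)
  have rates: "\<exists>\<rho>. 0 \<le> \<rho> \<and> \<rho> < 1 \<and> (\<forall>x0\<in>grids.
          (\<forall>l. max_norm N (\<lambda>i. (grid_map \<mu> a b N ^^ l) x0 i - x i)
              \<le> max_norm N (\<lambda>i. x0 i - x i)
                 * \<rho> ^ nat \<lfloor>real l / real (nat \<lceil>real N / 2\<rceil> - 1)\<rfloor>) \<and>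
          (strictly_log_concave_on {a<..<b} f \<longrightarrow>
            (\<forall>l. max_norm N (\<lambda>i. (grid_map \<mu> a b N ^^ l) x0 i - x i)
              \<le> max_norm N (\<lambda>i. x0 i - x i) * \<rho> ^ l)))"
    by (rule exI[of _ "max \<rho> \<sigma>"], intro conjI rate) (use \<rho> \<sigma> in auto)
  have optimal: "quadratic_optimal_grid \<mu> a b N ({a} \<union> x ` {2..N-1} \<union> {b})"
    "\<forall>\<Gamma>. quadratic_optimal_grid \<mu> a b N \<Gamma> \<longrightarrow> \<Gamma> = {a} \<union> x ` {2..N-1} \<union> {b}"
    using quadratic_optimal_grid_iff[OF x] by simp_all
  show ?thesis
    by (intro conjI exI[of _ x] maps x(1) fixed unique fixed_point_ordered[OF x] optimal rates)
qed

end
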